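(* Let $D=(V,A)$ be a finite digraph and $Q=\{B\subseteq A: D[B]\text{ is totally cyclic}\}$ ordered by inclusion. Then $$\psi_{NL}^D(x)=\sum_{B\in Q}(-1)^{rk_Q(B)}x^{rk(A/B)}.$$
   Context: Digraphs may have loops, parallel and antiparallel arcs. $D[B]$ is the subdigraph formed by the arcs of $B$ and their ends; it is totally cyclic if each of its (weakly) connected components is strongly connected ($\emptyset\in Q$). $rk_Q(B)$ is the maximum length $r$ of a chain $\emptyset=B_0\subsetneq B_1\subsetneq\dots\subsetneq B_r=B$ in $Q$. $A/B$ is the digraph obtained from $D$ by contracting the arcs of $B$, and for a digraph $Y$, $rk(Y)$ is its number of vertices minus its number of (weakly) connected components. Definition of $\psi_{NL}^D$: let $\mathcal U$ be the set of arc sets $C\subseteq A$ that are unions of arc sets of finitely many directed cycles of $D$ (including $\emptyset$); let $\mathcal C=\{A/C: C\in\mathcal U\}$ ordered by $A/C'\le A/C$ iff $C\subseteq C'$; let $\mu(A,Y)$ be the Möbius function value on the interval from $Y$ up to $A$ in this poset (equivalently $\mu(A,A/C)=\mu_{\mathcal U}(\emptyset,C)$ for the Möbius function of $\mathcal U$ ordered by inclusion). Then $\psi_{NL}^D(x)=\sum_{Y\in\mathcal C}\mu(A,Y)x^{rk(Y)}$. *)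

theory Defs
  imports
    "Graph_Theory.Digraph_Component"
    "HOL-Computational_Algebra.Polynomial"
begin

section \<open>Moebius function of a finite poset\<close>

text \<open>
  The poset is given by a carrier and a relation, with \<open>(a, b) \<in> le\<close> meaning that \<open>a\<close> is below
  \<open>b\<close>. The value is 0 outside the incidence relation, and also if the data is not a finite poset;
  the latter guard only serves termination.
\<close>

function moebius :: "'a set \<Rightarrow> 'a rel \<Rightarrow> 'a \<Rightarrow> 'a \<Rightarrow> int" where
  "moebius P le a b =
     (if finite P \<and> partial_order_on P le \<and> (a, b) \<in> le then
        if a = b then 1
        else - (\<Sum>z \<in> {z \<in> P. (a, z) \<in> le \<and> (z, b) \<in> le \<and> z \<noteq> b}. moebius P le a z)
      else 0)"
  by pat_completeness auto
termination
proof (relation "measure (\<lambda>(P, le, a, b). card {z \<in> P. (a, z) \<in> le \<and> (z, b) \<in> le})", goal_cases)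
  case 1
  show ?case by simp
next
  case (2 P le a b z)
  then have fin: "finite P" and po: "partial_order_on P le" and ab: "(a, b) \<in> le"
    and z: "(a, z) \<in> le" "(z, b) \<in> le" "z \<noteq> b"
    by auto
  have "trans le" "antisym le" "refl_on P le" "le \<subseteq> P \<times> P"
    using po by (auto simp: partial_order_on_def preorder_on_def)
  note ord = this
  let ?I = "\<lambda>b. {w \<in> P. (a, w) \<in> le \<and> (w, b) \<in> le}"
  have "?I z \<subseteq> ?I b"
    using z ord by (auto dest: transD)
  moreover have "b \<in> ?I b" "b \<notin> ?I z"
    using z ab ord by (auto dest: refl_onD antisymD)
  ultimately have "?I z \<subset> ?I b" by blast
  then show ?case
    using fin by (simp add: psubset_card_mono)
qed

declare moebius.simps [simp del]


section \<open>Weak components, rank and contraction\<close>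

definition weak_components :: "('a, 'b) pre_digraph \<Rightarrow> ('a, 'b) pre_digraph set" where
  "weak_components G = {H. pre_digraph.max_subgraph G connected H}"

definition digraph_rk :: "('a, 'b) pre_digraph \<Rightarrow> nat" where
  "digraph_rk G = card (verts G) - card (weak_components G)"

definition weak_class :: "('a, 'b) pre_digraph \<Rightarrow> 'a \<Rightarrow> 'a set" where
  "weak_class G v = {w. v \<rightarrow>\<^sup>*\<^bsub>with_proj (mk_symmetric G)\<^esub> w}"

text \<open>
  The contracted arcs disappear, every other arc is kept (possibly as a loop), and two vertices are
  identified iff they lie in the same weak component of the spanning subdigraph with arc set \<open>B\<close>.
  In particular the contraction by the empty set is \<open>D\<close> with each vertex \<open>v\<close> renamed to \<open>{v}\<close>.
\<close>

definition contract :: "('a, 'b) pre_digraph \<Rightarrow> 'b set \<Rightarrow> ('a set, 'b) pre_digraph" where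
  "contract D B =
     \<lparr> verts = weak_class (D\<lparr>arcs := B\<rparr>) ` verts D,
       arcs = arcs D - B,
       tail = (\<lambda>e. weak_class (D\<lparr>arcs := B\<rparr>) (tail D e)),
       head = (\<lambda>e. weak_class (D\<lparr>arcs := B\<rparr>) (head D e)) \<rparr>"


section \<open>The polynomial \<open>\<psi>\<^sub>N\<^sub>L\<close>\<close>

definition cycle_unions :: "('a, 'b) pre_digraph \<Rightarrow> 'b set set" where
  "cycle_unions D = {\<Union> (set ` S) | S. finite S \<and> (\<forall>p \<in> S. pre_digraph.cycle D p)}"

definition cycle_contractions :: "('a, 'b) pre_digraph \<Rightarrow> ('a set, 'b) pre_digraph set" where
  "cycle_contractions D = contract D ` cycle_unions D"

definition cycle_contraction_order :: "('a, 'b) pre_digraph \<Rightarrow> ('a set, 'b) pre_digraph rel" where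
  "cycle_contraction_order D =
     {(contract D C', contract D C) | C C'. C \<in> cycle_unions D \<and> C' \<in> cycle_unions D \<and> C \<subseteq> C'}"

text \<open>
  The top element of the poset, the digraph itself, is \<open>contract D {}\<close>.
\<close>

definition psi_NL :: "('a, 'b) pre_digraph \<Rightarrow> int poly" where
  "psi_NL D = (\<Sum>Y \<in> cycle_contractions D.
     monom (moebius (cycle_contractions D) (cycle_contraction_order D) Y (contract D {}))
       (digraph_rk Y))"


section \<open>Totally cyclic subdigraphs\<close>

definition arc_subdigraph :: "('a, 'b) pre_digraph \<Rightarrow> 'b set \<Rightarrow> ('a, 'b) pre_digraph" where
  "arc_subdigraph D B = D\<lparr>verts := tail D ` B \<union> head D ` B, arcs := B\<rparr>"

definition totally_cyclic :: "('a, 'b) pre_digraph \<Rightarrow> bool" where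
  "totally_cyclic G \<longleftrightarrow> (\<forall>H \<in> weak_components G. strongly_connected H)"

definition totally_cyclic_sets :: "('a, 'b) pre_digraph \<Rightarrow> 'b set set" where
  "totally_cyclic_sets D = {B. B \<subseteq> arcs D \<and> totally_cyclic (arc_subdigraph D B)}"

definition rk_Q :: "('a, 'b) pre_digraph \<Rightarrow> 'b set \<Rightarrow> nat" where
  "rk_Q D B = Max {r. \<exists>c :: nat \<Rightarrow> 'b set. c 0 = {} \<and> c r = B \<and>
     (\<forall>i \<le> r. c i \<in> totally_cyclic_sets D) \<and> (\<forall>i < r. c i \<subset> c (Suc i))}"


section \<open>The definitions above are applied to well-formed data\<close>

lemma cycle_unions_subset: "C \<in> cycle_unions D \<Longrightarrow> C \<subseteq> arcs D"
  by (fastforce simp: cycle_unions_def pre_digraph.cycle_def pre_digraph.awalk_def)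

lemma empty_in_cycle_unions: "{} \<in> cycle_unions D"
  unfolding cycle_unions_def by (rule CollectI, rule exI[of _ "{}"]) simp

lemma inj_on_contract: "inj_on (contract D) (cycle_unions D)"
proof (rule inj_onI)
  fix C C' assume C: "C \<in> cycle_unions D" "C' \<in> cycle_unions D" and eq: "contract D C = contract D C'"
  have "arcs D - C = arcs D - C'"
    using arg_cong[OF eq, of arcs] by (simp add: contract_def)
  then show "C = C'"
    using cycle_unions_subset[OF C(1)] cycle_unions_subset[OF C(2)] by blast
qed

lemma partial_order_on_cycle_contractions:
  "partial_order_on (cycle_contractions D) (cycle_contraction_order D)"
proof -
  note inj = inj_onD[OF inj_on_contract[of D]]
  have "trans (cycle_contraction_order D)"
  proof (rule transI)
    fix x y z assume "(x, y) \<in> cycle_contraction_order D" "(y, z) \<in> cycle_contraction_order D"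
    then obtain C1 C2 C3 C4 where
      "x = contract D C1" "y = contract D C2" "y = contract D C3" "z = contract D C4"
      "C2 \<subseteq> C1" "C4 \<subseteq> C3" "C1 \<in> cycle_unions D" "C2 \<in> cycle_unions D" "C3 \<in> cycle_unions D"
      "C4 \<in> cycle_unions D"
      unfolding cycle_contraction_order_def by blast
    moreover from this have "C2 = C3" using inj by metis
    ultimately show "(x, z) \<in> cycle_contraction_order D"
      unfolding cycle_contraction_order_def by blast
  qed
  moreover have "antisym (cycle_contraction_order D)"
  proof (rule antisymI)
    fix x y assume "(x, y) \<in> cycle_contraction_order D" "(y, x) \<in> cycle_contraction_order D"
    then obtain C1 C2 C3 C4 where
      "x = contract D C1" "y = contract D C2" "y = contract D C3" "x = contract D C4"
      "C2 \<subseteq> C1" "C4 \<subseteq> C3" "C1 \<in> cycle_unions D" "C2 \<in> cycle_unions D" "C3 \<in> cycle_unions D"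
      "C4 \<in> cycle_unions D"
      unfolding cycle_contraction_order_def by blast
    moreover from this have "C2 = C3" "C1 = C4" using inj by metis+
    ultimately show "x = y" by auto
  qed
  ultimately show ?thesis
    by (auto simp: partial_order_on_def preorder_on_def refl_on_def cycle_contractions_def
        cycle_contraction_order_def)
qed

lemma finite_cycle_contractions:
  assumes "fin_digraph D"
  shows "finite (cycle_contractions D)"
proof -
  have "cycle_unions D \<subseteq> Pow (arcs D)"
    using cycle_unions_subset by blast
  then show ?thesis
    unfolding cycle_contractions_def
    using fin_digraph.finite_arcs[OF assms] finite_subset by blast
qed

end

theory Submission
  imports Defs
begin

text \<open>
  A set of arcs is totally cyclic iff every arc has a directed return path inside the set, that is,
  iff the set is a union of directed cycles; these sets are the supports of the nonnegative
  circulations, hence the faces of a pointed polyhedral cone. The rank of such a set is its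
  cyclomatic number \<open>|C| - |V| + c(C)\<close>. The Euler relation on each interval \<open>[Z, C]\<close>, which
  is the poset of the digraph on \<open>C\<close> with \<open>Z\<close> contracted, is an identity of alternating sums
  proved by deletion, contraction and reversal of arcs. It says that the Moebius function of
  \<open>[Z, C]\<close> is the sign of the rank difference.
\<close>

section \<open>Counting the classes of a generated equivalence relation\<close>

text \<open>A direct induction over the arcs fails for a single orientation. Deleting and
  contracting an arc \<open>e\<close> controls only the Euler sum of the digraph together with that
  of the digraph in which \<open>e\<close> is reversed, because a circulation of the contraction may
  need flow through \<open>e\<close> in either direction. Hence one orientation with an evident sum
  has to be reached by reversals, and the relation is stated so as to include acyclic digraphs,
  where the sum is not zero. Intervals with arbitrary lower end \<open>Z\<close> are needed because
  the recursion of \<open>moebius\<close> keeps \<open>C\<close> fixed and lets \<open>Z\<close>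
  vary. That \<open>rk_Q\<close> agrees with the cyclomatic number requires chains without jumps;
  they come from closing one new arc by arcs that create no further undirected cycle.\<close>

definition equiv_cl :: "'v rel \<Rightarrow> 'v rel" where
  "equiv_cl R = (R \<union> R\<inverse>)\<^sup>*"

text \<open>The relation is an equivalence on the whole type, so the quotient of \<open>V\<close>
  counts the classes that meet \<open>V\<close>, isolated vertices included.\<close>

definition n_comps :: "'v set \<Rightarrow> 'v rel \<Rightarrow> nat" where
  "n_comps V R = card (V // equiv_cl R)"

lemma equiv_equiv_cl: "equiv UNIV (equiv_cl R)"
  by (auto simp: equiv_def equiv_cl_def intro: refl_rtrancl trans_rtrancl sym_rtrancl sym_Un_converse)

lemma equiv_cl_refl [simp]: "(x, x) \<in> equiv_cl R"
  by (simp add: equiv_cl_def)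

lemma equiv_cl_sym: "(x, y) \<in> equiv_cl R \<Longrightarrow> (y, x) \<in> equiv_cl R"
  using equiv_equiv_cl by (metis equivE symE)

lemma equiv_cl_trans: "(x, y) \<in> equiv_cl R \<Longrightarrow> (y, z) \<in> equiv_cl R \<Longrightarrow> (x, z) \<in> equiv_cl R"
  by (auto simp: equiv_cl_def)

lemma equiv_cl_mono: "R \<subseteq> S \<Longrightarrow> equiv_cl R \<subseteq> equiv_cl S"
  unfolding equiv_cl_def by (rule rtrancl_mono) auto

lemma rtrancl_subset_equiv_cl: "R\<^sup>* \<subseteq> equiv_cl R"
  unfolding equiv_cl_def by (rule rtrancl_mono) auto

lemma equiv_cl_insert:
  "equiv_cl (insert (u, v) R) =
     {(x, y). (x, y) \<in> equiv_cl R \<or>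
        x \<in> equiv_cl R `` {u} \<union> equiv_cl R `` {v} \<and> y \<in> equiv_cl R `` {u} \<union> equiv_cl R `` {v}}"
  (is "?L = ?R")
proof (intro subset_antisym subrelI)
  fix x y assume "(x, y) \<in> ?L"
  then show "(x, y) \<in> ?R"
    unfolding equiv_cl_def[of "insert _ _"]
  proof (induction rule: rtrancl_induct)
    case (step y z)
    from step.hyps(2) consider "(y, z) \<in> equiv_cl R" | "y = u" "z = v" | "y = v" "z = u"
      by (auto simp: equiv_cl_def)
    then show ?case
      using step.IH
    proof cases
      case 1
      then have "(w, z) \<in> equiv_cl R" if "(w, y) \<in> equiv_cl R" for w
        using that by (rule equiv_cl_trans[rotated])
      then show ?thesis using step.IH by blast
    next
      case 2
      then have "x \<in> equiv_cl R `` {u} \<union> equiv_cl R `` {v}"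
        using step.IH equiv_cl_sym[of x u] by auto
      then show ?thesis using 2 by auto
    next
      case 3
      then have "x \<in> equiv_cl R `` {u} \<union> equiv_cl R `` {v}"
        using step.IH equiv_cl_sym[of x v] by auto
      then show ?thesis using 3 by auto
    qed
  qed auto
next
  fix x y assume xy: "(x, y) \<in> ?R"
  have sub: "equiv_cl R \<subseteq> ?L" by (rule equiv_cl_mono) auto
  have uv: "(u, v) \<in> ?L" unfolding equiv_cl_def by auto
  have ux: "(u, x) \<in> ?L" if "x \<in> equiv_cl R `` {u} \<union> equiv_cl R `` {v}" for x
    using that sub uv by (auto intro: equiv_cl_trans[OF uv])
  from xy show "(x, y) \<in> ?L"
    using sub ux[of x] ux[of y] by (auto intro: equiv_cl_trans[OF equiv_cl_sym])
qed

lemma equiv_cl_insert_same: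
  assumes "(u, v) \<in> equiv_cl R"
  shows "equiv_cl (insert (u, v) R) = equiv_cl R"
proof -
  have "(u, x) \<in> equiv_cl R" if "x \<in> equiv_cl R `` {u} \<union> equiv_cl R `` {v}" for x
    using that by (auto intro: equiv_cl_trans[OF assms])
  then show ?thesis
    unfolding equiv_cl_insert by (blast intro: equiv_cl_trans[OF equiv_cl_sym])
qed

lemma n_comps_insert_same:
  "(u, v) \<in> equiv_cl R \<Longrightarrow> n_comps V (insert (u, v) R) = n_comps V R"
  by (simp add: n_comps_def equiv_cl_insert_same)

lemma n_comps_insert_merge:
  assumes "finite V" "u \<in> V" "v \<in> V" "(u, v) \<notin> equiv_cl R"
  shows "n_comps V R = Suc (n_comps V (insert (u, v) R))"
proof -
  let ?E = "equiv_cl R" and ?E' = "equiv_cl (insert (u, v) R)"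
  let ?u = "?E `` {u}" and ?v = "?E `` {v}"
  have cl: "?E' `` {x} = (if x \<in> ?u \<union> ?v then ?u \<union> ?v else ?E `` {x})" for x
  proof -
    have "(u, y) \<in> ?E" if "(u, x) \<in> ?E" "(x, y) \<in> ?E" for y
      using that by (rule equiv_cl_trans)
    moreover have "(v, y) \<in> ?E" if "(v, x) \<in> ?E" "(x, y) \<in> ?E" for y
      using that by (rule equiv_cl_trans)
    ultimately show ?thesis
      unfolding equiv_cl_insert by auto
  qed
  have eqc: "?E `` {x} = ?E `` {y} \<longleftrightarrow> (x, y) \<in> ?E" for x y
    using eq_equiv_class_iff[OF equiv_equiv_cl, of x y R] by simp
  have q: "V // ?E' = insert (?u \<union> ?v) (V // ?E - {?u, ?v})"
  proof (intro equalityI subsetI)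
    fix X assume "X \<in> V // ?E'"
    then obtain x where x: "x \<in> V" "X = ?E' `` {x}" by (auto simp: quotient_def)
    show "X \<in> insert (?u \<union> ?v) (V // ?E - {?u, ?v})"
    proof (cases "x \<in> ?u \<union> ?v")
      case True then show ?thesis using x cl by simp
    next
      case False
      then have "X = ?E `` {x}" using x cl by simp
      moreover have "?E `` {x} \<noteq> ?u" "?E `` {x} \<noteq> ?v"
        using False by (auto simp: eqc intro: equiv_cl_sym)
      ultimately show ?thesis using x by (auto simp: quotient_def)
    qed
  next
    fix X assume "X \<in> insert (?u \<union> ?v) (V // ?E - {?u, ?v})"
    then consider "X = ?u \<union> ?v" | x where "x \<in> V" "X = ?E `` {x}" "X \<noteq> ?u" "X \<noteq> ?v"
      by (auto simp: quotient_def)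
    then show "X \<in> V // ?E'"
    proof cases
      case 1
      then have "X = ?E' `` {u}" using cl[of u] by auto
      then show ?thesis using assms by (auto simp: quotient_def)
    next
      case (2 x)
      then have "(x, u) \<notin> ?E" "(x, v) \<notin> ?E" using eqc by blast+
      then have "x \<notin> ?u \<union> ?v" using equiv_cl_sym by fast
      then have "X = ?E' `` {x}" using 2 cl[of x] by simp
      then show ?thesis using 2 by (auto simp: quotient_def)
    qed
  qed
  \<comment> \<open>The merged class has to be new; otherwise inserting it would not offset one of
    the two removed classes.\<close>
  have new: "?u \<union> ?v \<notin> V // ?E"
  proof
    assume "?u \<union> ?v \<in> V // ?E"
    then obtain x where x: "?u \<union> ?v = ?E `` {x}" by (auto simp: quotient_def)
    have "u \<in> ?u \<union> ?v" "v \<in> ?u \<union> ?v" by simp_all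
    then have "(x, u) \<in> ?E" "(x, v) \<in> ?E" unfolding x by simp_all
    then have "(u, v) \<in> ?E" by (rule equiv_cl_trans[OF equiv_cl_sym])
    then show False using assms(4) by simp
  qed
  have fin: "finite (V // ?E)"
    using assms(1) by (simp add: quotient_def)
  have mem: "?u \<in> V // ?E" "?v \<in> V // ?E" "?u \<noteq> ?v"
    using assms eqc by (auto simp: quotient_def)
  have "card (V // ?E') = Suc (card (V // ?E - {?u, ?v}))"
    using q new fin by (simp add: card_insert_if)
  also have "card (V // ?E - {?u, ?v}) = card (V // ?E) - 2"
    using mem fin by (simp add: card_Diff_subset)
  finally have "card (V // ?E') = Suc (card (V // ?E) - 2)" .
  \<comment> \<open>The subtraction above is truncated; two distinct classes make it exact.\<close>
  moreover have "card (V // ?E) \<ge> 2"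
    using card_mono[OF fin, of "{?u, ?v}"] mem by simp
  ultimately show ?thesis by (simp add: n_comps_def)
qed

lemma n_comps_empty: "n_comps V {} = card V"
proof -
  have "V // equiv_cl {} = (\<lambda>x. {x}) ` V" by (auto simp: equiv_cl_def quotient_def)
  then show ?thesis by (simp add: n_comps_def card_image)
qed

section \<open>Totally cyclic arc sets modulo a contracted relation\<close>

text \<open>
  An arc \<open>e\<close> has the pair of ends \<open>p e = (tail, head)\<close>. The symmetric relation \<open>F\<close> stands for
  contracted arcs: its pairs may be traversed freely in both directions, so that contraction needs
  no relabelling of vertices.
\<close>

definition circ_sets :: "('b \<Rightarrow> 'v \<times> 'v) \<Rightarrow> 'v rel \<Rightarrow> 'b set \<Rightarrow> 'b set set" where
  "circ_sets p F A = {C. C \<subseteq> A \<and> (\<forall>e \<in> C. prod.swap (p e) \<in> (p ` C \<union> F)\<^sup>*)}"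

text \<open>Modulo \<open>F\<close> there are \<open>n_comps V F\<close> vertices, so up to the
  factor \<open>(-1) ^ n_comps V F\<close>, which does not depend on \<open>C\<close>, this is the
  sign of the cyclomatic number of \<open>C\<close>, the dimension of its face. Leaving the factor
  out avoids subtraction in the exponent.\<close>

definition comp_sign :: "'v set \<Rightarrow> ('b \<Rightarrow> 'v \<times> 'v) \<Rightarrow> 'v rel \<Rightarrow> 'b set \<Rightarrow> int" where
  "comp_sign V p F C = (-1) ^ (card C + n_comps V (p ` C \<union> F))"

lemma circ_sets_empty [simp]: "{} \<in> circ_sets p F A"
  by (simp add: circ_sets_def)

lemma finite_circ_sets: "finite A \<Longrightarrow> finite (circ_sets p F A)"
  by (rule finite_subset[of _ "Pow A"]) (auto simp: circ_sets_def)

lemma circ_sets_bounded: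
  assumes "C \<in> circ_sets p F A" "finite A" "p ` A \<subseteq> X"
  shows "finite C" "p ` C \<subseteq> X"
proof -
  have "C \<subseteq> A" using assms(1) by (simp add: circ_sets_def)
  then show "finite C" "p ` C \<subseteq> X" using assms(2,3) finite_subset by blast+
qed

text \<open>Each arc can be undone along its return path and each pair of \<open>F\<close> by
  symmetry, so undirected and directed reachability coincide. This links return paths to component
  counts.\<close>

lemma circ_sets_equiv_cl:
  assumes "C \<in> circ_sets p F A" "sym F"
  shows "equiv_cl (p ` C \<union> F) = (p ` C \<union> F)\<^sup>*"
proof -
  have "(p ` C \<union> F)\<inverse> \<subseteq> (p ` C \<union> F)\<^sup>*"
  proof (rule subrelI)
    fix x y assume "(x, y) \<in> (p ` C \<union> F)\<inverse>"
    then consider e where "e \<in> C" "p e = (y, x)" | "(x, y) \<in> F"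
      using symD[OF assms(2)] by (auto simp: eq_commute)
    then show "(x, y) \<in> (p ` C \<union> F)\<^sup>*"
      using assms(1) by cases (force simp: circ_sets_def)+
  qed
  then have "(p ` C \<union> F) \<union> (p ` C \<union> F)\<inverse> \<subseteq> (p ` C \<union> F)\<^sup>*" by auto
  then show ?thesis
    unfolding equiv_cl_def by (metis rtrancl_subset Un_upper1)
qed

text \<open>Whenever a walk from \<open>v\<close> uses the new pair it is back at its start, so
  everything up to there can be cut off.\<close>

lemma rtrancl_insert_return:
  assumes "(v, u) \<in> (insert (u, v) R)\<^sup>*"
  shows "(v, u) \<in> R\<^sup>*"
proof -
  have "(v, w) \<in> R\<^sup>*" if "(v, w) \<in> (insert (u, v) R)\<^sup>*" for w
    using that by (induction rule: rtrancl_induct) (auto intro: rtrancl_into_rtrancl)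
  then show ?thesis using assms by blast
qed

lemma rtrancl_subsumed: "S \<subseteq> (R :: 'v rel)\<^sup>* \<Longrightarrow> (S \<union> R)\<^sup>* = R\<^sup>*"
  by (rule rtrancl_subset) auto

text \<open>Cut the walk at its first and its last visit to \<open>{u, v}\<close>.\<close>

lemma rtrancl_two_arcs:
  assumes "(y, x) \<in> ({(u, v), (v, u)} \<union> R)\<^sup>*"
  shows "(y, x) \<in> R\<^sup>* \<or> (\<exists>s \<in> {u, v}. \<exists>s' \<in> {u, v}. (y, s) \<in> R\<^sup>* \<and> (s', x) \<in> R\<^sup>*)"
  using assms
proof (induction rule: rtrancl_induct)
  case (step x z)
  show ?case
  proof (cases "(x, z) \<in> R")
    case True
    then have "(w, z) \<in> R\<^sup>*" if "(w, x) \<in> R\<^sup>*" for w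
      using that by (rule rtrancl_into_rtrancl[rotated])
    then show ?thesis using step.IH by blast
  next
    case False
    then have "x \<in> {u, v}" "z \<in> {u, v}" using step.hyps(2) by auto
    then show ?thesis using step.IH by blast
  qed
qed simp

section \<open>Totally cyclic sets when one arc is deleted, contracted or reversed\<close>

context
  fixes p :: "'b \<Rightarrow> 'v \<times> 'v" and F :: "'v rel" and A :: "'b set" and e :: 'b and u v :: 'v
  assumes e: "e \<notin> A" "p e = (u, v)" and symF: "sym F"
begin

abbreviation (input) "p_rev \<equiv> p(e := (v, u))"
abbreviation (input) "F_con \<equiv> {(u, v), (v, u)} \<union> F"

lemma image_rev: "C \<subseteq> A \<Longrightarrow> p_rev ` C = p ` C"
  using e by (intro image_cong) auto

lemma circ_sets_rev: "circ_sets p_rev F A = circ_sets p F A"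
proof -
  have "\<forall>a \<in> C. p_rev a = p a" if "C \<subseteq> A" for C using that e by auto
  then show ?thesis
    unfolding circ_sets_def by (intro Collect_cong conj_cong refl ball_cong) (simp_all add: image_rev)
qed

text \<open>The return path of \<open>e\<close> can avoid \<open>e\<close> itself, whereas the other
  return paths may run through \<open>e\<close>.\<close>

lemma circ_sets_insert_iff:
  assumes "C \<subseteq> A"
  shows "insert e C \<in> circ_sets p F (insert e A) \<longleftrightarrow>
    (v, u) \<in> (p ` C \<union> F)\<^sup>* \<and> (\<forall>a \<in> C. prod.swap (p a) \<in> (insert (u, v) (p ` C \<union> F))\<^sup>*)"
proof -
  have "(v, u) \<in> (insert (u, v) (p ` C \<union> F))\<^sup>* \<longleftrightarrow> (v, u) \<in> (p ` C \<union> F)\<^sup>*"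
    using rtrancl_insert_return[of v u "p ` C \<union> F"]
      rtrancl_mono[OF subset_insertI[of "p ` C \<union> F" "(u, v)"]] by auto
  then show ?thesis
    using assms e by (auto simp: circ_sets_def)
qed

lemma circ_sets_insert_rev_iff:
  assumes "C \<subseteq> A"
  shows "insert e C \<in> circ_sets p_rev F (insert e A) \<longleftrightarrow>
    (u, v) \<in> (p ` C \<union> F)\<^sup>* \<and> (\<forall>a \<in> C. prod.swap (p a) \<in> (insert (v, u) (p ` C \<union> F))\<^sup>*)"
proof -
  have "(u, v) \<in> (insert (v, u) (p ` C \<union> F))\<^sup>* \<longleftrightarrow> (u, v) \<in> (p ` C \<union> F)\<^sup>*"
    using rtrancl_insert_return[of u v "p ` C \<union> F"]
      rtrancl_mono[OF subset_insertI[of "p ` C \<union> F" "(v, u)"]] by auto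
  moreover have "p_rev ` insert e C = insert (v, u) (p ` C)"
    unfolding image_insert image_rev[OF assms] by simp
  moreover have "\<forall>a \<in> C. p_rev a = p a" using assms e by auto
  ultimately show ?thesis
    using assms e by (auto simp: circ_sets_def)
qed

text \<open>A circulation of the contraction lifts to the original vertices once \<open>e\<close>
  carries the imbalance between its two ends. Zero, positive and negative imbalance correspond to
  the three alternatives. In terms of walks, the cases are decided by whether \<open>C\<close> and
  \<open>F\<close> already lead from \<open>v\<close> to \<open>u\<close> or from \<open>u\<close>
  to \<open>v\<close>.\<close>

lemma circ_sets_contract_iff:
  assumes C: "C \<subseteq> A"
  shows "C \<in> circ_sets p F_con A \<longleftrightarrow>
    C \<in> circ_sets p F A \<or> insert e C \<in> circ_sets p F (insert e A) \<or>
    insert e C \<in> circ_sets p_rev F (insert e A)"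
  (is "?con \<longleftrightarrow> ?del \<or> ?pos \<or> ?neg")
proof
  let ?R = "p ` C \<union> F"
  have con: "?con \<longleftrightarrow> (\<forall>a \<in> C. prod.swap (p a) \<in> ({(u, v), (v, u)} \<union> ?R)\<^sup>*)"
    using C by (simp add: circ_sets_def Un_left_commute Un_insert_right)
  {
    assume "?del \<or> ?pos \<or> ?neg"
    moreover have "?R\<^sup>* \<subseteq> ({(u, v), (v, u)} \<union> ?R)\<^sup>*"
      "(insert (u, v) ?R)\<^sup>* \<subseteq> ({(u, v), (v, u)} \<union> ?R)\<^sup>*"
      "(insert (v, u) ?R)\<^sup>* \<subseteq> ({(u, v), (v, u)} \<union> ?R)\<^sup>*"
      by (rule rtrancl_mono; blast)+
    ultimately show ?con
      unfolding con circ_sets_insert_iff[OF C] circ_sets_insert_rev_iff[OF C]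
      by (auto simp: circ_sets_def)
  next
    assume ?con
    note ret = this[unfolded con]
    show "?del \<or> ?pos \<or> ?neg"
    proof (cases "(v, u) \<in> ?R\<^sup>*")
      case True
      \<comment> \<open>The pair \<open>(v, u)\<close> is already realised by a walk in
        \<open>?R\<close>, so of the two contracted directions only the forward one has to be
        supplied, by \<open>e\<close>.\<close>
      have "({(v, u)} \<union> insert (u, v) ?R)\<^sup>* = (insert (u, v) ?R)\<^sup>*"
        by (rule rtrancl_subsumed) (use True rtrancl_mono[of ?R "insert (u, v) ?R"] in auto)
      then have ?pos
        using ret True unfolding circ_sets_insert_iff[OF C] by (simp add: insert_commute)
      then show ?thesis by simp
    next
      case notvu: False
      show ?thesis
      proof (cases "(u, v) \<in> ?R\<^sup>*")
        case True
        have "({(u, v)} \<union> insert (v, u) ?R)\<^sup>* = (insert (v, u) ?R)\<^sup>*"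
          by (rule rtrancl_subsumed) (use True rtrancl_mono[of ?R "insert (v, u) ?R"] in auto)
        then have ?neg
          using ret True unfolding circ_sets_insert_rev_iff[OF C] by (simp add: insert_commute)
        then show ?thesis by simp
      next
        case notuv: False
        \<comment> \<open>A return path entering the contracted vertex at one of \<open>u\<close>, \<open>v\<close> and leaving it at the
          other one would, together with its arc, connect \<open>u\<close> and \<open>v\<close>.\<close>
        have "prod.swap (p a) \<in> ?R\<^sup>*" if a: "a \<in> C" for a
        proof -
          obtain x y where xy: "p a = (x, y)" by fastforce
          then have "(x, y) \<in> ?R" using a by force
          then have "(s', s) \<in> ?R\<^sup>*" if "(y, s) \<in> ?R\<^sup>*" "(s', x) \<in> ?R\<^sup>*" for s s'
            using that by (meson rtrancl_into_rtrancl rtrancl_trans)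
          moreover have "(y, x) \<in> ?R\<^sup>*" if "(y, s) \<in> ?R\<^sup>*" "(s, x) \<in> ?R\<^sup>*" for s
            using that by (rule rtrancl_trans)
          ultimately show ?thesis
            using rtrancl_two_arcs[of y x u v ?R] ret[rule_format, OF a] notuv notvu
            unfolding xy by auto
        qed
        then show ?thesis using C by (auto simp: circ_sets_def)
      qed
    qed
  }
qed

lemma circ_sets_connected:
  assumes "C \<in> circ_sets p F A" "(u, v) \<in> equiv_cl (p ` C \<union> F)"
  shows "insert e C \<in> circ_sets p F (insert e A)" "insert e C \<in> circ_sets p_rev F (insert e A)"
proof -
  let ?R = "p ` C \<union> F"
  have C: "C \<subseteq> A" using assms by (simp add: circ_sets_def)
  have "(u, v) \<in> ?R\<^sup>*" "(v, u) \<in> ?R\<^sup>*"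
    using assms(2) equiv_cl_sym[OF assms(2)] unfolding circ_sets_equiv_cl[OF assms(1) symF] .
  moreover have "?R\<^sup>* \<subseteq> (insert (u, v) ?R)\<^sup>*" "?R\<^sup>* \<subseteq> (insert (v, u) ?R)\<^sup>*"
    by (rule rtrancl_mono; blast)+
  ultimately show "insert e C \<in> circ_sets p F (insert e A)" "insert e C \<in> circ_sets p_rev F (insert e A)"
    using assms(1) unfolding circ_sets_insert_iff[OF C] circ_sets_insert_rev_iff[OF C]
    by (auto simp: circ_sets_def)
qed

text \<open>Adding a circulation through \<open>e\<close> and one through the reversed arc cancels
  \<open>e\<close>. Here \<open>C\<close> supplies a walk from \<open>v\<close> to \<open>u\<close>
  and \<open>C'\<close> one from \<open>u\<close> to \<open>v\<close>, so both directions of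
  \<open>e\<close> become redundant in all return paths.\<close>

lemma circ_sets_both_union:
  assumes "C \<subseteq> A" "C' \<subseteq> A" "insert e C \<in> circ_sets p F (insert e A)"
    "insert e C' \<in> circ_sets p_rev F (insert e A)"
  shows "C \<union> C' \<in> circ_sets p F A"
proof -
  let ?R = "p ` (C \<union> C') \<union> F"
  have sub: "(p ` C \<union> F)\<^sup>* \<subseteq> ?R\<^sup>*" "(p ` C' \<union> F)\<^sup>* \<subseteq> ?R\<^sup>*"
    by (rule rtrancl_mono; blast)+
  have "(v, u) \<in> ?R\<^sup>*" "(u, v) \<in> ?R\<^sup>*"
    using assms(3,4) sub unfolding circ_sets_insert_iff[OF assms(1)] circ_sets_insert_rev_iff[OF assms(2)]
    by auto
  then have "({(u, v), (v, u)} \<union> ?R)\<^sup>* = ?R\<^sup>*"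
    by (intro rtrancl_subsumed) auto
  moreover have "(insert (u, v) (p ` C \<union> F))\<^sup>* \<subseteq> ({(u, v), (v, u)} \<union> ?R)\<^sup>*"
      "(insert (v, u) (p ` C' \<union> F))\<^sup>* \<subseteq> ({(u, v), (v, u)} \<union> ?R)\<^sup>*"
    by (rule rtrancl_mono; blast)+
  ultimately have "\<forall>a \<in> C \<union> C'. prod.swap (p a) \<in> ?R\<^sup>*"
    using assms(3,4) unfolding circ_sets_insert_iff[OF assms(1)] circ_sets_insert_rev_iff[OF assms(2)]
    by auto
  then show ?thesis using assms(1,2) by (simp add: circ_sets_def)
qed

lemma circ_sets_both:
  assumes "C \<subseteq> A" "insert e C \<in> circ_sets p F (insert e A)"
    "insert e C \<in> circ_sets p_rev F (insert e A)"
  shows "C \<in> circ_sets p F A"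
  using circ_sets_both_union[of C C] assms by simp

text \<open>Writing the sum over all subsets of \<open>A\<close> with indicators gives deletion,
  contraction and both orientations the same index set, so that they can be compared term by
  term.\<close>

lemma sum_circ_sets_insert:
  assumes "finite A"
  shows "sum f (circ_sets p F (insert e A)) =
    (\<Sum>C \<in> Pow A. (if C \<in> circ_sets p F A then f C else 0) +
      (if insert e C \<in> circ_sets p F (insert e A) then f (insert e C) else (0 :: int)))"
proof -
  let ?Q = "circ_sets p F (insert e A)"
  have "?Q \<subseteq> Pow (insert e A)" by (auto simp: circ_sets_def)
  then have "sum f ?Q = (\<Sum>C \<in> Pow (insert e A). if C \<in> ?Q then f C else 0)"
    using assms by (simp add: sum.If_cases Int_absorb1)
  also have "Pow (insert e A) = Pow A \<union> insert e ` Pow A"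
    by (rule Pow_insert)
  also have "(\<Sum>C \<in> Pow A \<union> insert e ` Pow A. if C \<in> ?Q then f C else 0) =
      (\<Sum>C \<in> Pow A. if C \<in> ?Q then f C else 0) + (\<Sum>C \<in> insert e ` Pow A. if C \<in> ?Q then f C else 0)"
    using assms e by (intro sum.union_disjoint) auto
  also have "(\<Sum>C \<in> insert e ` Pow A. if C \<in> ?Q then f C else 0) =
      (\<Sum>C \<in> Pow A. if insert e C \<in> ?Q then f (insert e C) else 0)"
  proof (subst sum.reindex)
    show "inj_on (insert e) (Pow A)" using e by (auto intro!: inj_onI)
  qed simp
  also have "(\<Sum>C \<in> Pow A. if C \<in> ?Q then f C else 0) =
      (\<Sum>C \<in> Pow A. if C \<in> circ_sets p F A then f C else 0)"
    by (intro sum.cong) (auto simp: circ_sets_def)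
  finally show ?thesis by (simp add: sum.distrib)
qed

end

section \<open>Recurrences for the signed sum and for acyclicity\<close>

lemma sum_circ_sets:
  "finite A \<Longrightarrow> sum f (circ_sets p F A) = (\<Sum>C \<in> Pow A. if C \<in> circ_sets p F A then f C else (0::int))"
  by (subst sum.If_cases) (auto intro!: sum.cong simp: circ_sets_def)

lemma equiv_cl_insert_swap: "equiv_cl (insert (v, u) R) = equiv_cl (insert (u, v) R)"
  unfolding equiv_cl_def by (rule arg_cong[where f = rtrancl]) auto

lemma equiv_cl_insert_both: "equiv_cl (insert (v, u) (insert (u, v) R)) = equiv_cl (insert (u, v) R)"
  unfolding equiv_cl_def by (rule arg_cong[where f = rtrancl]) auto

lemma comp_sign_rev:
  assumes "p e = (u, v)" "e \<notin> C"
  shows "comp_sign V (p(e := (v, u))) F C = comp_sign V p F C"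
    and "comp_sign V (p(e := (v, u))) F (insert e C) = comp_sign V p F (insert e C)"
proof -
  have img: "p(e := (v, u)) ` C = p ` C" using assms(2) by (intro image_cong) auto
  show "comp_sign V (p(e := (v, u))) F C = comp_sign V p F C"
    unfolding comp_sign_def img ..
  show "comp_sign V (p(e := (v, u))) F (insert e C) = comp_sign V p F (insert e C)"
    unfolding comp_sign_def image_insert img n_comps_def
    by (simp add: assms(1) equiv_cl_insert_swap[of v u])
qed

lemma comp_sign_insert:
  assumes "p e = (u, v)" "e \<notin> C" "finite C" "finite V" "u \<in> V" "v \<in> V"
  shows "comp_sign V p F (insert e C) =
    (if (u, v) \<in> equiv_cl (p ` C \<union> F) then - comp_sign V p F C else comp_sign V p F C)"
  using assms n_comps_insert_merge[of V u v "p ` C \<union> F"]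
  by (auto simp: comp_sign_def n_comps_insert_same)

text \<open>Contracting \<open>e\<close> and adding \<open>e\<close> merge the same classes; only
  the number of arcs differs, by one.\<close>

lemma comp_sign_contract:
  assumes "p e = (u, v)" "e \<notin> C" "finite C"
  shows "comp_sign V p ({(u, v), (v, u)} \<union> F) C = - comp_sign V p F (insert e C)"
  using assms by (simp add: comp_sign_def n_comps_def insert_commute[of "(u, v)"] equiv_cl_insert_both)

text \<open>This is the additivity of the Euler characteristic: the cone of the contraction is cut
  by the vanishing of the flow in \<open>e\<close> into the cones of the two orientations, which
  meet in the cone of the deletion. If \<open>e\<close> is not a loop modulo \<open>F\<close>, the
  minus sign only reflects that contraction leaves one class fewer in the omitted factor. The
  identity holds separately for each \<open>C\<close>.\<close>

lemma sum_comp_sign_recurrence: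
  assumes "e \<notin> A" "p e = (u, v)" "sym F" "finite A" "finite V" "u \<in> V" "v \<in> V"
  shows "sum (comp_sign V p F) (circ_sets p F (insert e A)) +
    sum (comp_sign V (p(e := (v, u))) F) (circ_sets (p(e := (v, u))) F (insert e A)) =
    sum (comp_sign V p F) (circ_sets p F A) -
    sum (comp_sign V p ({(u, v), (v, u)} \<union> F)) (circ_sets p ({(u, v), (v, u)} \<union> F) A)"
    (is "?pos + ?neg = ?del - ?con")
proof -
  let ?q = "p(e := (v, u))" and ?G = "{(u, v), (v, u)} \<union> F"
  let ?s = "comp_sign V p F"
  have q: "?q e = (v, u)" "?q(e := (u, v)) = p" using assms(2) by auto
  note rev = circ_sets_rev[where p = p, OF assms(1,2,3)]
  have pos: "?pos = (\<Sum>C \<in> Pow A. (if C \<in> circ_sets p F A then ?s C else 0) +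
      (if insert e C \<in> circ_sets p F (insert e A) then ?s (insert e C) else 0))"
    by (rule sum_circ_sets_insert[where p = p, OF assms(1,2,3,4)])
  have neg: "?neg = (\<Sum>C \<in> Pow A. (if C \<in> circ_sets p F A then ?s C else 0) +
      (if insert e C \<in> circ_sets ?q F (insert e A) then ?s (insert e C) else 0))"
    unfolding sum_circ_sets_insert[where p = ?q, OF assms(1) q(1) assms(3,4)] rev
  proof (rule sum.cong[OF refl])
    fix C assume "C \<in> Pow A"
    then have "e \<notin> C" using assms(1) by auto
    then show "(if C \<in> circ_sets p F A then comp_sign V ?q F C else 0) +
        (if insert e C \<in> circ_sets ?q F (insert e A) then comp_sign V ?q F (insert e C) else 0) =
        (if C \<in> circ_sets p F A then ?s C else 0) +
        (if insert e C \<in> circ_sets ?q F (insert e A) then ?s (insert e C) else 0)"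
      using comp_sign_rev[of p e u v C V F] assms(2) by simp
  qed
  have con: "?con = (\<Sum>C \<in> Pow A. if C \<in> circ_sets p ?G A then - ?s (insert e C) else 0)"
    unfolding sum_circ_sets[OF assms(4)]
  proof (rule sum.cong[OF refl])
    fix C assume "C \<in> Pow A"
    then have "e \<notin> C" "finite C" using assms(1,4) finite_subset by auto
    then show "(if C \<in> circ_sets p ?G A then comp_sign V p ?G C else 0) =
        (if C \<in> circ_sets p ?G A then - ?s (insert e C) else 0)"
      using comp_sign_contract[of p e u v C V F] assms(2) by simp
  qed
  have pt: "((if C \<in> circ_sets p F A then ?s C else 0) +
        (if insert e C \<in> circ_sets p F (insert e A) then ?s (insert e C) else 0)) +
      ((if C \<in> circ_sets p F A then ?s C else 0) +
        (if insert e C \<in> circ_sets ?q F (insert e A) then ?s (insert e C) else 0)) =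
      (if C \<in> circ_sets p F A then ?s C else 0) -
      (if C \<in> circ_sets p ?G A then - ?s (insert e C) else 0)" if "C \<in> Pow A" for C
  proof -
    have C: "C \<subseteq> A" "e \<notin> C" "finite C" using that assms(1,4) finite_subset by auto
    let ?P = "insert e C \<in> circ_sets p F (insert e A)" and ?N = "insert e C \<in> circ_sets ?q F (insert e A)"
    let ?conn = "(u, v) \<in> equiv_cl (p ` C \<union> F)"
    have iff: "C \<in> circ_sets p ?G A \<longleftrightarrow> C \<in> circ_sets p F A \<or> ?P \<or> ?N"
      using circ_sets_contract_iff[where p = p, OF assms(1,2,3) C(1)] .
    have both: "?P \<Longrightarrow> ?N \<Longrightarrow> C \<in> circ_sets p F A"
      using circ_sets_both[where p = p, OF assms(1,2,3) C(1)] .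
    have strong: "C \<in> circ_sets p F A \<Longrightarrow> ?conn \<Longrightarrow> ?P \<and> ?N"
      using circ_sets_connected[where p = p, OF assms(1,2,3)] by blast
    have weak: "?P \<or> ?N \<Longrightarrow> ?conn"
      unfolding circ_sets_insert_iff[where p = p, OF assms(1,2,3) C(1)] circ_sets_insert_rev_iff[where p = p, OF assms(1,2,3) C(1)]
      using rtrancl_subset_equiv_cl[of "p ` C \<union> F"] equiv_cl_sym[of v u "p ` C \<union> F"] by auto
    have sgn: "?s (insert e C) = (if ?conn then - ?s C else ?s C)"
      by (rule comp_sign_insert[where p = p, OF assms(2) C(2,3) assms(5-7)])
    \<comment> \<open>If \<open>C\<close> is itself totally cyclic, \<open>e\<close> can be added in
      both orientations or in neither, depending on whether \<open>C\<close> connects its ends.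
      Otherwise at most one orientation is possible.\<close>
    consider "C \<in> circ_sets p F A" ?P ?N ?conn | "C \<in> circ_sets p F A" "\<not> ?P" "\<not> ?N" "\<not> ?conn"
      | "C \<notin> circ_sets p F A" ?P "\<not> ?N" | "C \<notin> circ_sets p F A" "\<not> ?P" ?N
      | "C \<notin> circ_sets p F A" "\<not> ?P" "\<not> ?N"
      using both strong weak by argo
    then show ?thesis
      unfolding iff by cases (simp_all add: sgn)
  qed
  show ?thesis
    unfolding pos neg con sum_circ_sets[OF assms(4), of ?s]
    unfolding sum.distrib[symmetric] sum_subtractf[symmetric]
    by (rule sum.cong[OF refl], rule pt)
qed

text \<open>If the deletion is acyclic, at most one orientation of \<open>e\<close> closes a cycle,
  and the contraction is acyclic exactly if neither does. If the deletion has a cycle, all four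
  terms vanish.\<close>

lemma acyclic_recurrence:
  assumes "e \<notin> A" "p e = (u, v)" "sym F" "(u, v) \<notin> F\<^sup>*"
  shows "of_bool (circ_sets p F (insert e A) = {{}}) +
    of_bool (circ_sets (p(e := (v, u))) F (insert e A) = {{}}) =
    of_bool (circ_sets p F A = {{}}) +
    (of_bool (circ_sets p ({(u, v), (v, u)} \<union> F) A = {{}}) :: int)"
proof -
  let ?q = "p(e := (v, u))" and ?G = "{(u, v), (v, u)} \<union> F"
  have q: "?q e = (v, u)" using assms(2) by auto
  define P where "P = {C. C \<subseteq> A \<and> insert e C \<in> circ_sets p F (insert e A)}"
  define N where "N = {C. C \<subseteq> A \<and> insert e C \<in> circ_sets ?q F (insert e A)}"
  let ?Q = "circ_sets p F A"
  have con: "circ_sets p ?G A = ?Q \<union> P \<union> N"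
  proof (rule set_eqI)
    fix C
    show "C \<in> circ_sets p ?G A \<longleftrightarrow> C \<in> ?Q \<union> P \<union> N"
    proof (cases "C \<subseteq> A")
      case True
      then show ?thesis using circ_sets_contract_iff[where p = p, OF assms(1,2,3) True] by (auto simp: P_def N_def)
    qed (auto simp: P_def N_def circ_sets_def)
  qed
  have split: "circ_sets r F (insert e A) = circ_sets r F A \<union> insert e ` {C. C \<subseteq> A \<and> insert e C \<in> circ_sets r F (insert e A)}"
    for r
  proof (rule set_eqI)
    fix C
    show "C \<in> circ_sets r F (insert e A) \<longleftrightarrow>
      C \<in> circ_sets r F A \<union> insert e ` {C. C \<subseteq> A \<and> insert e C \<in> circ_sets r F (insert e A)}"
    proof (cases "e \<in> C")
      case True
      then have ins: "C = insert e (C - {e})" by auto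
      have notA: "C \<notin> circ_sets r F A" using True assms(1) by (auto simp: circ_sets_def)
      show ?thesis
      proof
        assume C: "C \<in> circ_sets r F (insert e A)"
        moreover have "C - {e} \<subseteq> A" using C by (auto simp: circ_sets_def)
        ultimately have "C - {e} \<in> {C. C \<subseteq> A \<and> insert e C \<in> circ_sets r F (insert e A)}"
          using ins by simp
        then show "C \<in> circ_sets r F A \<union> insert e ` {C. C \<subseteq> A \<and> insert e C \<in> circ_sets r F (insert e A)}"
          using ins by blast
      qed (use notA in auto)
    qed (auto simp: circ_sets_def)
  qed
  have pos: "circ_sets p F (insert e A) = ?Q \<union> insert e ` P"
    using split[of p] by (simp add: P_def)
  have neg: "circ_sets ?q F (insert e A) = ?Q \<union> insert e ` N"
    using split[of ?q] circ_sets_rev[where p = p, OF assms(1,2,3)] by (simp add: N_def)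
  have "(v, u) \<notin> F\<^sup>*"
    using assms(3,4) by (meson symD sym_rtrancl)
  then have ne: "{} \<notin> P" "{} \<notin> N"
    using assms(4) circ_sets_insert_iff[where p = p, OF assms(1-3), of "{}"]
      circ_sets_insert_rev_iff[where p = p, OF assms(1-3), of "{}"] by (auto simp: P_def N_def)
  have both: "C \<union> C' \<in> ?Q" if "C \<in> P" "C' \<in> N" for C C'
    using circ_sets_both_union[where p = p, OF assms(1-3)] that by (auto simp: P_def N_def)
  show ?thesis
  proof (cases "?Q = {{}}")
    case True
    \<comment> \<open>Members of \<open>P\<close> and \<open>N\<close> are nonempty since
      \<open>e\<close> is not a loop modulo \<open>F\<close>, and the union of one of each would be
      a nonempty member of \<open>?Q\<close>.\<close>
    then have "P = {} \<or> N = {}" using both ne by fastforce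
    moreover have "circ_sets p F (insert e A) = {{}} \<longleftrightarrow> P = {}"
      "circ_sets ?q F (insert e A) = {{}} \<longleftrightarrow> N = {}"
      "circ_sets p ?G A = {{}} \<longleftrightarrow> P = {} \<and> N = {}"
      using True ne unfolding pos neg con by auto
    ultimately show ?thesis using True by auto
  next
    case False
    moreover have "{} \<in> ?Q" by simp
    ultimately obtain C where "C \<in> ?Q" "C \<noteq> {}" by blast
    then have "circ_sets p F (insert e A) \<noteq> {{}}" "circ_sets ?q F (insert e A) \<noteq> {{}}"
      "circ_sets p ?G A \<noteq> {{}}"
      unfolding pos neg con by auto
    then show ?thesis using False by simp
  qed
qed

section \<open>Loops, potentials and the Euler relation\<close>

lemma circ_sets_loop:
  assumes "e \<notin> A" "p e \<in> F\<^sup>*" "sym F" "C \<subseteq> A"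
  shows "insert e C \<in> circ_sets p F (insert e A) \<longleftrightarrow> C \<in> circ_sets p F A"
proof -
  obtain u v where uv: "p e = (u, v)" by fastforce
  have sub: "F\<^sup>* \<subseteq> (p ` C \<union> F)\<^sup>*" by (rule rtrancl_mono) auto
  have "(v, u) \<in> F\<^sup>*" using assms(2,3) uv by (metis symD sym_rtrancl)
  moreover have "({(u, v)} \<union> (p ` C \<union> F))\<^sup>* = (p ` C \<union> F)\<^sup>*"
    by (rule rtrancl_subsumed) (use assms(2) uv sub in auto)
  ultimately show ?thesis
    unfolding circ_sets_insert_iff[where p = p, OF assms(1) uv assms(3,4)]
    using sub assms(4) by (auto simp: circ_sets_def)
qed

text \<open>Adding the loop is always possible and changes the number of arcs but not the
  components, so the terms of \<open>C\<close> and \<open>insert e C\<close> cancel.\<close>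

lemma sum_comp_sign_loop:
  assumes "e \<notin> A" "p e \<in> F\<^sup>*" "sym F" "finite A" "finite V" "p e \<in> V \<times> V"
  shows "sum (comp_sign V p F) (circ_sets p F (insert e A)) = 0"
proof -
  obtain u v where uv: "p e = (u, v)" by fastforce
  have "(if C \<in> circ_sets p F A then comp_sign V p F C else 0) +
      (if insert e C \<in> circ_sets p F (insert e A) then comp_sign V p F (insert e C) else 0) = 0"
    if "C \<in> Pow A" for C
  proof -
    have C: "C \<subseteq> A" "e \<notin> C" "finite C" using that assms(1,4) finite_subset by auto
    have "F\<^sup>* \<subseteq> equiv_cl (p ` C \<union> F)"
      using rtrancl_mono[of F "p ` C \<union> F"] rtrancl_subset_equiv_cl[of "p ` C \<union> F"] by auto
    then have "(u, v) \<in> equiv_cl (p ` C \<union> F)" using assms(2) uv by auto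
    then have "comp_sign V p F (insert e C) = - comp_sign V p F C"
      using comp_sign_insert[of p e u v C V F] uv C assms(5,6) by simp
    then show ?thesis using circ_sets_loop[where p = p, OF assms(1-3) C(1)] by simp
  qed
  then show ?thesis
    unfolding sum_circ_sets_insert[where p = p, OF assms(1) uv assms(3,4)] by (simp add: sum.neutral)
qed

text \<open>The potential \<open>rho\<close> never descends along a walk, but a return path would
  have to bring it back down.\<close>

lemma circ_sets_increasing:
  fixes rho :: "'v \<Rightarrow> nat"
  assumes "\<And>x y. (x, y) \<in> F \<Longrightarrow> rho x = rho y" "\<And>e. e \<in> A \<Longrightarrow> rho (fst (p e)) < rho (snd (p e))"
  shows "circ_sets p F A = {{}}"
proof -
  have "C = {}" if C: "C \<in> circ_sets p F A" for C
  proof (rule ccontr)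
    assume "C \<noteq> {}"
    then obtain e where e: "e \<in> C" by auto
    have CA: "C \<subseteq> A" using C by (simp add: circ_sets_def)
    have mono: "rho x \<le> rho y" if "(x, y) \<in> (p ` C \<union> F)\<^sup>*" for x y
      using that
    proof (induction rule: rtrancl_induct)
      case (step y z)
      then consider b where "b \<in> C" "p b = (y, z)" | "(y, z) \<in> F" by (auto simp: eq_commute)
      then have "rho y \<le> rho z"
        using assms(1)[of y z] assms(2) CA by cases (fastforce simp: less_imp_le)+
      then show ?case using step.IH by simp
    qed simp
    have "prod.swap (p e) \<in> (p ` C \<union> F)\<^sup>*" using C e by (simp add: circ_sets_def)
    then have "rho (snd (p e)) \<le> rho (fst (p e))"
      using mono[of "snd (p e)" "fst (p e)"] by (simp add: prod.swap_def)
    then show False using assms(2)[of e] e CA by auto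
  qed
  moreover have "{} \<in> circ_sets p F A" by simp
  ultimately show ?thesis by blast
qed

text \<open>
  The sum is the Euler characteristic of the cone of nonnegative circulations, whose faces are the
  totally cyclic sets. The defect between both sides changes sign when an arc is reversed, by
  induction on the deletion and the contraction of that arc, and it vanishes for an acyclic
  orientation.
\<close>

lemma sum_comp_sign_circ_sets:
  fixes p :: "'b \<Rightarrow> 'v \<times> 'v"
  assumes "finite V" "finite A" "p ` A \<subseteq> V \<times> V" "sym F"
  shows "sum (comp_sign V p F) (circ_sets p F A) = of_bool (circ_sets p F A = {{}}) * (-1) ^ n_comps V F"
  using assms(2-)
proof (induction "card A" arbitrary: A p F rule: less_induct)
  case less
  show ?case
  proof (cases "\<exists>e \<in> A. p e \<in> F\<^sup>*")
    case True
    then obtain e where e: "e \<in> A" "p e \<in> F\<^sup>*" by blast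
    define A' where "A' = A - {e}"
    have A': "A = insert e A'" "e \<notin> A'" "finite A'" using e less.prems by (auto simp: A'_def)
    have "insert e {} \<in> circ_sets p F A"
      unfolding A'(1) by (subst circ_sets_loop) (use A' e less.prems in auto)
    then have "circ_sets p F A \<noteq> {{}}" by auto
    moreover have "sum (comp_sign V p F) (circ_sets p F A) = 0"
      unfolding A'(1) using A' e less.prems assms(1) by (intro sum_comp_sign_loop) auto
    ultimately show ?thesis by simp
  next
    case False
    have finq: "finite (V // F\<^sup>*)" using assms(1) by (simp add: quotient_def)
    \<comment> \<open>Any injective numbering of the classes modulo \<open>F\<close> serves: no arc
      is a loop modulo \<open>F\<close>, so each arc can be oriented towards the larger number,
      which gives an acyclic digraph.\<close>
    obtain g :: "'v set \<Rightarrow> nat" where g: "inj_on g (V // F\<^sup>*)"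
      using finite_imp_inj_to_nat_seg[OF finq] by blast
    define rho where "rho x = g (F\<^sup>* `` {x})" for x
    have eqv: "equiv UNIV (F\<^sup>*)"
      using less.prems(3) by (auto simp: equiv_def intro: refl_rtrancl trans_rtrancl sym_rtrancl)
    have rhoF: "rho x = rho y" if "(x, y) \<in> F" for x y
      using equiv_class_eq[OF eqv r_into_rtrancl[OF that]] by (simp add: rho_def)
    have rho_inj: "(x, y) \<in> F\<^sup>*" if "rho x = rho y" "x \<in> V" "y \<in> V" for x y
    proof -
      have "F\<^sup>* `` {x} = F\<^sup>* `` {y}"
        using that inj_onD[OF g] by (simp add: rho_def quotientI)
      then show ?thesis using eq_equiv_class[OF _ eqv] by simp
    qed
    \<comment> \<open>With \<open>A\<close> and \<open>F\<close> fixed, the orientation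
      \<open>r\<close> varies, and the induction is on the number of arcs that do not ascend in
      \<open>rho\<close>. The outer induction on \<open>card A\<close> supplies deletion and
      contraction, including the loops that contraction may create.\<close>
    have "sum (comp_sign V r F) (circ_sets r F A) = of_bool (circ_sets r F A = {{}}) * (-1) ^ n_comps V F"
      if "r ` A \<subseteq> V \<times> V" "\<forall>e \<in> A. r e \<notin> F\<^sup>*" for r
      using that
    proof (induction "card {e \<in> A. rho (snd (r e)) \<le> rho (fst (r e))}" arbitrary: r rule: less_induct)
      case inner: less
      show ?case
      proof (cases "\<exists>e \<in> A. rho (snd (r e)) \<le> rho (fst (r e))")
        case False
        then have "circ_sets r F A = {{}}"
          by (intro circ_sets_increasing[of F rho]) (auto simp: rhoF not_le)
        then show ?thesis by (simp add: comp_sign_def)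
      next
        case True
        then obtain e where e: "e \<in> A" "rho (snd (r e)) \<le> rho (fst (r e))" by blast
        obtain u v where uv: "r e = (u, v)" by fastforce
        have V: "u \<in> V" "v \<in> V" using inner.prems(1) e(1) uv by auto
        have nuv: "(u, v) \<notin> F\<^sup>*" using inner.prems(2) e(1) uv by auto
        then have "rho u \<noteq> rho v" using rho_inj V by blast
        then have less_rho: "rho v < rho u" using e(2) uv by simp
        define A' where "A' = A - {e}"
        have A': "A = insert e A'" "e \<notin> A'" "finite A'" "card A' < card A"
          using e less.prems(1) card_Diff1_less[of A e] by (auto simp: A'_def simp del: card_Diff_insert)
        let ?q = "r(e := (v, u))" and ?G = "{(u, v), (v, u)} \<union> F"
        have nvu: "(v, u) \<notin> F\<^sup>*" using nuv less.prems(3) by (meson symD sym_rtrancl)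
        have IHq: "sum (comp_sign V ?q F) (circ_sets ?q F A) =
            of_bool (circ_sets ?q F A = {{}}) * (-1) ^ n_comps V F"
        proof (rule inner.hyps)
          show "?q ` A \<subseteq> V \<times> V" using inner.prems(1) V by auto
          show "\<forall>a \<in> A. ?q a \<notin> F\<^sup>*" using inner.prems(2) nvu by auto
          show "card {a \<in> A. rho (snd (?q a)) \<le> rho (fst (?q a))} <
              card {a \<in> A. rho (snd (r a)) \<le> rho (fst (r a))}"
          proof (rule psubset_card_mono)
            show "finite {a \<in> A. rho (snd (r a)) \<le> rho (fst (r a))}" using less.prems(1) by simp
            show "{a \<in> A. rho (snd (?q a)) \<le> rho (fst (?q a))} \<subset> {a \<in> A. rho (snd (r a)) \<le> rho (fst (r a))}"
              using e less_rho by (auto split: if_splits)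
          qed
        qed
        have rA': "r ` A' \<subseteq> V \<times> V" using inner.prems(1) A'(1) by auto
        have del: "sum (comp_sign V r F) (circ_sets r F A') =
            of_bool (circ_sets r F A' = {{}}) * (-1) ^ n_comps V F"
          by (rule less.hyps[OF A'(4,3) rA' less.prems(3)])
        have "sym ?G" using less.prems(3) by (auto simp: sym_def)
        then have con: "sum (comp_sign V r ?G) (circ_sets r ?G A') =
            of_bool (circ_sets r ?G A' = {{}}) * (-1) ^ n_comps V ?G"
          by (rule less.hyps[OF A'(4,3) rA'])
        \<comment> \<open>The contraction merges two classes and so flips the sign of its right
          side. This turns the difference in \<open>sum_comp_sign_recurrence\<close> into the sum in
          \<open>acyclic_recurrence\<close>.\<close>
        have "equiv_cl F = F\<^sup>*"
          using circ_sets_equiv_cl[of "{}" r F A] less.prems(3) by simp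
        then have "n_comps V F = Suc (n_comps V (insert (u, v) F))"
          using n_comps_insert_merge[OF assms(1) V] nuv by simp
        moreover have "n_comps V ?G = n_comps V (insert (u, v) F)"
          using equiv_cl_insert_both[of u v F] by (simp add: n_comps_def equiv_cl_insert_swap)
        ultimately have sgn: "(-1 :: int) ^ n_comps V ?G = - ((-1) ^ n_comps V F)"
          by simp
        have "sum (comp_sign V r F) (circ_sets r F A) + sum (comp_sign V ?q F) (circ_sets ?q F A) =
            sum (comp_sign V r F) (circ_sets r F A') - sum (comp_sign V r ?G) (circ_sets r ?G A')"
          unfolding A'(1)
          by (rule sum_comp_sign_recurrence[where p = r, OF A'(2) uv less.prems(3) A'(3) assms(1) V])
        also have "\<dots> = (of_bool (circ_sets r F A' = {{}}) + of_bool (circ_sets r ?G A' = {{}})) *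
            (-1) ^ n_comps V F"
          unfolding del con sgn by (simp add: algebra_simps)
        also have "of_bool (circ_sets r F A' = {{}}) + of_bool (circ_sets r ?G A' = {{}}) =
            of_bool (circ_sets r F A = {{}}) + (of_bool (circ_sets ?q F A = {{}}) :: int)"
          unfolding A'(1) by (rule acyclic_recurrence[where p = r, OF A'(2) uv less.prems(3) nuv, symmetric])
        finally show ?thesis unfolding IHq by (simp add: algebra_simps)
      qed
    qed
    then show ?thesis using False less.prems(2) by blast
  qed
qed

section \<open>The rank of a totally cyclic set is its cyclomatic number\<close>

definition nullity :: "'v set \<Rightarrow> ('b \<Rightarrow> 'v \<times> 'v) \<Rightarrow> 'b set \<Rightarrow> nat" where
  "nullity V p C = card C + n_comps V (p ` C) - card V"

text \<open>Each arc lowers the number of components by at most one, hence the truncated subtraction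
  in \<open>nullity\<close> is exact.\<close>

lemma nullity_eq:
  assumes "finite V" "finite C" "p ` C \<subseteq> V \<times> V"
  shows "nullity V p C + card V = card C + n_comps V (p ` C)"
proof -
  have "card V \<le> card C + n_comps V (p ` C)"
    using assms(2,3)
  proof (induction C rule: finite_induct)
    case (insert e C)
    obtain u v where uv: "p e = (u, v)" by fastforce
    then have "u \<in> V" "v \<in> V" using insert.prems by auto
    then have "n_comps V (p ` C) \<le> Suc (n_comps V (p ` insert e C))"
      using n_comps_insert_same[of u v "p ` C" V] n_comps_insert_merge[OF assms(1), of u v "p ` C"] uv
      by (cases "(u, v) \<in> equiv_cl (p ` C)") auto
    then show ?case using insert by simp
  qed (simp add: n_comps_empty)
  then show ?thesis by (simp add: nullity_def)
qed

lemma nullity_insert: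
  assumes "finite V" "finite C" "p ` insert e C \<subseteq> V \<times> V" "e \<notin> C"
  shows "nullity V p (insert e C) = nullity V p C + of_bool (p e \<in> equiv_cl (p ` C))"
proof -
  obtain u v where uv: "p e = (u, v)" by fastforce
  then have V: "u \<in> V" "v \<in> V" using assms(3) by auto
  have "nullity V p C + card V = card C + n_comps V (p ` C)"
    using assms by (intro nullity_eq) auto
  moreover have "nullity V p (insert e C) + card V = Suc (card C) + n_comps V (insert (u, v) (p ` C))"
    using nullity_eq[of V "insert e C" p] assms uv by simp
  ultimately show ?thesis
    using n_comps_insert_same[of u v "p ` C" V] n_comps_insert_merge[OF assms(1) V, of "p ` C"] uv
    by (cases "(u, v) \<in> equiv_cl (p ` C)") auto
qed

lemma nullity_mono:
  assumes "finite V" "finite C'" "p ` C' \<subseteq> V \<times> V" "C \<subseteq> C'"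
  shows "nullity V p C \<le> nullity V p C'"
proof -
  have "nullity V p C \<le> nullity V p (C \<union> X)" if "finite X" "p ` X \<subseteq> V \<times> V" for X
    using that
  proof (induction X rule: finite_induct)
    case (insert e X)
    show ?case
    proof (cases "e \<in> C")
      case True
      then show ?thesis using insert by (simp add: insert_absorb)
    next
      case False
      have "finite (C \<union> X)" using insert.hyps assms(2,4) finite_subset by auto
      moreover have "p ` insert e (C \<union> X) \<subseteq> V \<times> V" using insert.prems assms(3,4) by blast
      ultimately have "nullity V p (C \<union> X) \<le> nullity V p (insert e (C \<union> X))"
        using nullity_insert[OF assms(1), of "C \<union> X" p e] False insert.hyps(2) by simp
      then show ?thesis using insert by simp
    qed
  qed simp
  from this[OF assms(2,3)] show ?thesis using assms(4) by (simp add: Un_absorb1)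
qed

text \<open>An arc of \<open>C'\<close> outside \<open>C\<close> has a return path in the rest of
  \<open>C'\<close>, so removing it keeps the components and lowers the nullity by one.\<close>

lemma nullity_strict_mono:
  assumes "finite V" "finite C'" "p ` C' \<subseteq> V \<times> V" "C \<subset> C'" "C' \<in> circ_sets p {} A"
  shows "nullity V p C < nullity V p C'"
proof -
  obtain e where e: "e \<in> C'" "e \<notin> C" using assms(4) by auto
  obtain u v where uv: "p e = (u, v)" by fastforce
  let ?D = "C' - {e}"
  have D: "C' = insert e ?D" using e by auto
  have "(v, u) \<in> (p ` C')\<^sup>*" using assms(5) e uv by (force simp: circ_sets_def)
  moreover have "p ` C' = insert (u, v) (p ` ?D)" by (subst D) (simp only: image_insert uv)
  ultimately have "(v, u) \<in> (insert (u, v) (p ` ?D))\<^sup>*" by simp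
  then have "(v, u) \<in> (p ` ?D)\<^sup>*" by (rule rtrancl_insert_return)
  then have "p e \<in> equiv_cl (p ` ?D)"
    unfolding uv using rtrancl_subset_equiv_cl[of "p ` ?D"] equiv_cl_sym[of v u] by auto
  then have "nullity V p C' = nullity V p ?D + 1"
    using nullity_insert[OF assms(1), of ?D p e] assms(2,3) unfolding D[symmetric] by simp
  moreover have "nullity V p C \<le> nullity V p ?D"
    using assms e by (intro nullity_mono) auto
  ultimately show ?thesis by simp
qed

section \<open>Saturated chains of totally cyclic sets\<close>

lemma equiv_cl_imp_reaches:
  assumes "C \<in> circ_sets p {} A" "\<forall>b \<in> P. (snd (p b), y) \<in> (p ` (C \<union> P))\<^sup>*"
    and "(y, w) \<in> equiv_cl (p ` (C \<union> P))"
  shows "(w, y) \<in> (p ` (C \<union> P))\<^sup>*"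
  using assms(3) unfolding equiv_cl_def
proof (induction rule: rtrancl_induct)
  case (step w z)
  \<comment> \<open>Moving away from \<open>y\<close>, a step against an arc can be retraced
    directly, a step along an arc of \<open>C\<close> by its return path, and a step along an arc of
    \<open>P\<close> ends at a head, which reaches \<open>y\<close> by assumption.\<close>
  consider "(z, w) \<in> p ` (C \<union> P)" | b where "b \<in> C" "p b = (w, z)" | b where "b \<in> P" "p b = (w, z)"
    using step.hyps(2) by (auto simp: eq_commute)
  then show ?case
  proof cases
    case 1
    then show ?thesis using step.IH by (rule converse_rtrancl_into_rtrancl)
  next
    case 2
    then have "(z, w) \<in> (p ` C)\<^sup>*" using assms(1) by (force simp: circ_sets_def)
    then have "(z, w) \<in> (p ` (C \<union> P))\<^sup>*" using rtrancl_mono[of "p ` C" "p ` (C \<union> P)"] by auto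
    then show ?thesis using step.IH by (rule rtrancl_trans)
  next
    case 3
    then show ?thesis using assms(2) by force
  qed
qed simp

text \<open>\<open>P\<close> is grown backwards from \<open>y\<close>, and an arc is added only if
  its tail does not reach \<open>y\<close> yet. By \<open>equiv_cl_imp_reaches\<close> the tail then
  lies in another weak component, so no undirected cycle arises. \<open>P\<close> may branch, which
  is why it is only required that heads reach \<open>y\<close>.\<close>

lemma path_without_new_cycles:
  assumes "finite V" "finite C'" "p ` C' \<subseteq> V \<times> V" "C \<in> circ_sets p {} A" "C \<subseteq> C'"
    and "(x, y) \<in> (p ` C')\<^sup>*"
  shows "\<exists>P \<subseteq> C'. (x, y) \<in> (p ` (C \<union> P))\<^sup>* \<and> (\<forall>b \<in> P. (snd (p b), y) \<in> (p ` (C \<union> P))\<^sup>*) \<and>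
    nullity V p (C \<union> P) = nullity V p C"
  using assms(6)
proof (induction rule: converse_rtrancl_induct)
  case base
  then show ?case by (intro exI[of _ "{}"]) auto
next
  case (step x z)
  then obtain P where P: "P \<subseteq> C'" "(z, y) \<in> (p ` (C \<union> P))\<^sup>*"
    "\<forall>b \<in> P. (snd (p b), y) \<in> (p ` (C \<union> P))\<^sup>*" "nullity V p (C \<union> P) = nullity V p C"
    by blast
  obtain a where a: "a \<in> C'" "p a = (x, z)" using step.hyps(1) by (auto simp: eq_commute)
  let ?R = "p ` (C \<union> P)"
  show ?case
  proof (cases "(x, y) \<in> ?R\<^sup>*")
    case True
    then show ?thesis using P by blast
  next
    case False
    then have "(x, z) \<notin> ?R"
      using P(2) by (meson converse_rtrancl_into_rtrancl)
    then have aP: "a \<notin> C \<union> P" using a(2) by (metis imageI)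
    have "(x, z) \<notin> equiv_cl ?R"
    proof
      assume "(x, z) \<in> equiv_cl ?R"
      moreover have "(z, y) \<in> equiv_cl ?R" using P(2) rtrancl_subset_equiv_cl[of ?R] by auto
      ultimately have "(y, x) \<in> equiv_cl ?R" by (rule equiv_cl_sym[OF equiv_cl_trans])
      then show False using equiv_cl_imp_reaches[OF assms(4) P(3)] False by blast
    qed
    moreover have "finite (C \<union> P)" "p ` insert a (C \<union> P) \<subseteq> V \<times> V"
      using assms(2,3,5) P(1) a(1) finite_subset by auto
    ultimately have null: "nullity V p (insert a (C \<union> P)) = nullity V p C"
      using nullity_insert[OF assms(1), of "C \<union> P" p a] aP a(2) P(4) by simp
    have img: "p ` (C \<union> insert a P) = insert (x, z) ?R" using a(2) by simp
    have sub: "?R\<^sup>* \<subseteq> (p ` (C \<union> insert a P))\<^sup>*" by (rule rtrancl_mono) auto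
    have zy: "(z, y) \<in> (p ` (C \<union> insert a P))\<^sup>*" using P(2) sub by blast
    have "(x, z) \<in> p ` (C \<union> insert a P)" unfolding img by simp
    then have "(x, y) \<in> (p ` (C \<union> insert a P))\<^sup>*" using zy by (rule converse_rtrancl_into_rtrancl)
    moreover have "\<forall>b \<in> insert a P. (snd (p b), y) \<in> (p ` (C \<union> insert a P))\<^sup>*"
      using zy P(3) sub a(2) by auto
    ultimately show ?thesis
      using null P(1) a(1) by (intro exI[of _ "insert a P"]) simp
  qed
qed

text \<open>An arc of \<open>C' - C\<close> is closed by a return walk that adds no nullity to
  \<open>C\<close>; then only the arc itself can add one. Strict monotonicity forces the
  increase.\<close>

lemma circ_sets_cover:
  assumes "finite V" "finite C'" "p ` C' \<subseteq> V \<times> V" "C \<in> circ_sets p {} A" "C' \<in> circ_sets p {} A"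
    and "C \<subset> C'"
  shows "\<exists>C'' \<in> circ_sets p {} A. C \<subset> C'' \<and> C'' \<subseteq> C' \<and> nullity V p C'' = Suc (nullity V p C)"
proof -
  obtain e where e: "e \<in> C'" "e \<notin> C" using assms(6) by auto
  obtain u v where uv: "p e = (u, v)" by fastforce
  have "(v, u) \<in> (p ` C')\<^sup>*" using assms(5) e uv by (force simp: circ_sets_def)
  from path_without_new_cycles[OF assms(1-4) psubset_imp_subset[OF assms(6)] this]
  obtain P where P: "P \<subseteq> C'" "(v, u) \<in> (p ` (C \<union> P))\<^sup>*"
    "\<forall>b \<in> P. (snd (p b), u) \<in> (p ` (C \<union> P))\<^sup>*" "nullity V p (C \<union> P) = nullity V p C"
    by blast
  let ?R = "p ` (C \<union> P)"
  \<comment> \<open>\<open>P\<close> may have branches that no walk from \<open>v\<close> enters,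
    and their arcs could lack return paths. Only arcs whose tail is reachable from \<open>v\<close>
    are kept; walks from \<open>v\<close> are unaffected.\<close>
  define P0 where "P0 = {b \<in> P. (v, fst (p b)) \<in> ?R\<^sup>*}"
  let ?S = "p ` (C \<union> P0)"
  have RS: "(a, w) \<in> ?S\<^sup>*" if "(a, w) \<in> ?R\<^sup>*" "(v, a) \<in> ?R\<^sup>*" for a w
    using that(1)
  proof (induction rule: rtrancl_induct)
    case (step w z)
    have "(v, w) \<in> ?R\<^sup>*" using that(2) step.hyps(1) by (rule rtrancl_trans)
    moreover obtain b where "b \<in> C \<union> P" "p b = (w, z)" using step.hyps(2) by (metis imageE)
    ultimately have "(w, z) \<in> ?S" unfolding P0_def by force
    with step.IH show ?case by (rule rtrancl_into_rtrancl)
  qed simp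
  define C'' where "C'' = insert e (C \<union> P0)"
  have sub: "C \<subset> C''" "C'' \<subseteq> C'"
    using e assms(6) P(1) by (auto simp: C''_def P0_def)
  have img: "p ` C'' = insert (u, v) ?S" using uv by (simp add: C''_def)
  have ST: "?S\<^sup>* \<subseteq> (p ` C'')\<^sup>*" unfolding img by (rule rtrancl_mono) auto
  have CT: "(p ` C)\<^sup>* \<subseteq> (p ` C'')\<^sup>*" by (rule rtrancl_mono) (use sub in auto)
  have vu: "(v, u) \<in> (p ` C'')\<^sup>*" using RS[OF P(2)] ST by auto
  have uv': "(u, v) \<in> (p ` C'')\<^sup>*" unfolding img by auto
  have "prod.swap (p b) \<in> (p ` C'')\<^sup>*" if bC: "b \<in> C''" for b
  proof -
    consider "b = e" | "b \<in> C" | "b \<in> P0" using bC by (auto simp: C''_def)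
    then show ?thesis
    proof cases
      case 1
      then show ?thesis using vu uv by simp
    next
      case 2
      then show ?thesis using assms(4) CT by (auto simp: circ_sets_def)
    next
      case 3
      then have b: "b \<in> P" "(v, fst (p b)) \<in> ?R\<^sup>*" by (auto simp: P0_def)
      then have "(fst (p b), snd (p b)) \<in> ?R" by auto
      with b(2) have "(v, snd (p b)) \<in> ?R\<^sup>*" by (rule rtrancl_into_rtrancl)
      then have "(snd (p b), u) \<in> ?S\<^sup>*" using RS P(3) b(1) by blast
      moreover have "(v, fst (p b)) \<in> ?S\<^sup>*" using RS[OF b(2)] by simp
      \<comment> \<open>The return path goes from the head to \<open>u\<close>, along
        \<open>e\<close> to \<open>v\<close>, and on to the tail.\<close>
      ultimately have "(snd (p b), fst (p b)) \<in> (p ` C'')\<^sup>*"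
        using ST uv' by (meson rtrancl_trans subsetD)
      then show ?thesis by (simp add: prod.swap_def)
    qed
  qed
  then have C'': "C'' \<in> circ_sets p {} A"
    using sub(2) assms(5) by (auto simp: circ_sets_def)
  have fin: "finite C''" "p ` C'' \<subseteq> V \<times> V" using sub(2) assms(2,3) finite_subset by blast+
  have "nullity V p C < nullity V p C''"
    by (rule nullity_strict_mono[OF assms(1) fin sub(1) C''])
  moreover have "nullity V p C'' \<le> Suc (nullity V p C)"
  proof -
    have fin': "finite (C \<union> P)" "p ` (C \<union> P) \<subseteq> V \<times> V"
      using P(1) assms(2,3,6) finite_subset[of "C \<union> P" C'] by blast+
    have "nullity V p (C \<union> P0) \<le> nullity V p (C \<union> P)"
      by (rule nullity_mono[OF assms(1) fin']) (auto simp: P0_def)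
    moreover have "nullity V p C'' \<le> Suc (nullity V p (C \<union> P0))"
    proof (cases "e \<in> C \<union> P0")
      case True
      then show ?thesis by (simp add: C''_def insert_absorb)
    next
      case False
      then show ?thesis
        using nullity_insert[OF assms(1), of "C \<union> P0" p e] fin by (simp add: C''_def)
    qed
    ultimately show ?thesis using P(4) by simp
  qed
  ultimately show ?thesis using C'' sub by (intro bexI[of _ C'']) auto
qed

text \<open>The cover above a maximal proper member \<open>B\<close> below \<open>C\<close> can only
  be \<open>C\<close>, so \<open>B\<close> has nullity exactly one less, and its chain is extended
  by \<open>C\<close>.\<close>

lemma circ_sets_chain:
  assumes "finite V" "finite A" "p ` A \<subseteq> V \<times> V" "C \<in> circ_sets p {} A"
  shows "\<exists>c :: nat \<Rightarrow> 'b set. c 0 = {} \<and> c (nullity V p C) = C \<and>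
    (\<forall>i \<le> nullity V p C. c i \<in> circ_sets p {} A) \<and> (\<forall>i < nullity V p C. c i \<subset> c (Suc i))"
  using assms(4)
proof (induction "nullity V p C" arbitrary: C rule: less_induct)
  case less
  note sub = circ_sets_bounded[OF _ assms(2,3)]
  show ?case
  proof (cases "C = {}")
    case True
    then have "nullity V p C = 0" by (simp add: nullity_def n_comps_empty)
    then show ?thesis using True by (intro exI[of _ "\<lambda>_. {}"]) simp
  next
    case False
    define S where "S = {B \<in> circ_sets p {} A. B \<subset> C}"
    have "finite S" using finite_circ_sets[OF assms(2), of p "{}"] by (simp add: S_def)
    moreover have "S \<noteq> {}" using False by (auto simp: S_def intro!: exI[of _ "{}"])
    ultimately obtain B where B: "B \<in> S" "\<forall>B' \<in> S. B \<subseteq> B' \<longrightarrow> B' = B"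
      using finite_has_maximal[of S] by metis
    then have BQ: "B \<in> circ_sets p {} A" "B \<subset> C" by (auto simp: S_def)
    obtain C'' where C'': "C'' \<in> circ_sets p {} A" "B \<subset> C''" "C'' \<subseteq> C" "nullity V p C'' = Suc (nullity V p B)"
      using circ_sets_cover[OF assms(1) sub[OF less.prems] BQ(1) less.prems BQ(2)] by blast
    then have "C'' = C" using B(2) by (auto simp: S_def)
    then have n: "nullity V p C = Suc (nullity V p B)" using C''(4) by simp
    then obtain c where c: "c 0 = {}" "c (nullity V p B) = B"
      "\<forall>i \<le> nullity V p B. c i \<in> circ_sets p {} A" "\<forall>i < nullity V p B. c i \<subset> c (Suc i)"
      using less.hyps[OF _ BQ(1)] by auto
    define d where "d i = (if i \<le> nullity V p B then c i else C)" for i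
    have "\<forall>i < nullity V p C. d i \<subset> d (Suc i)"
    proof (intro allI impI)
      fix i assume "i < nullity V p C"
      then consider "i < nullity V p B" | "i = nullity V p B" using n by linarith
      then show "d i \<subset> d (Suc i)"
        using c BQ(2) by cases (auto simp: d_def)
    qed
    then show ?thesis
      using c n less.prems by (intro exI[of _ d]) (auto simp: d_def)
  qed
qed

lemma chain_length_le_nullity:
  assumes "finite V" "finite A" "p ` A \<subseteq> V \<times> V"
    and "\<forall>i \<le> r. c i \<in> circ_sets p {} A" "\<forall>i < r. c i \<subset> c (Suc i)"
  shows "r \<le> nullity V p (c r)"
proof -
  have "i \<le> nullity V p (c i)" if "i \<le> r" for i
    using that
  proof (induction i)
    case (Suc i)
    then have Q: "c (Suc i) \<in> circ_sets p {} A" "c i \<subset> c (Suc i)" using assms(4,5) by auto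
    have "nullity V p (c i) < nullity V p (c (Suc i))"
      by (rule nullity_strict_mono[OF assms(1) circ_sets_bounded[OF Q(1) assms(2,3)] Q(2,1)])
    then show ?case using Suc by simp
  qed simp
  then show ?thesis by simp
qed

text \<open>Contracting \<open>Z\<close> turns the interval into all totally cyclic sets on
  \<open>C - Z\<close>. Since \<open>C - Z\<close> is a nonempty one, the Euler relation gives
  zero.\<close>

lemma sum_sign_interval:
  assumes "finite V" "finite A" "p ` A \<subseteq> V \<times> V"
    and "Z \<in> circ_sets p {} A" "C \<in> circ_sets p {} A" "Z \<subset> C"
  shows "(\<Sum>B \<in> {B \<in> circ_sets p {} A. Z \<subseteq> B \<and> B \<subseteq> C}. (-1 :: int) ^ nullity V p B) = 0"
proof -
  define F where "F = p ` Z \<union> (p ` Z)\<inverse>"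
  have symF: "sym F" unfolding F_def by (rule sym_Un_converse)
  have subA: "Z \<subseteq> A" "C \<subseteq> A" using assms(4,5) by (auto simp: circ_sets_def)
  have finC: "finite C" "p ` C \<subseteq> V \<times> V"
    by (rule circ_sets_bounded[OF assms(5,2,3)])+
  then have finCZ: "finite (C - Z)" "p ` (C - Z) \<subseteq> V \<times> V" by auto
  \<comment> \<open>As \<open>Z\<close> is totally cyclic, traversing its arcs backwards adds no
    reachability; so \<open>F\<close> has the same effect as keeping the arcs of
    \<open>Z\<close>.\<close>
  have "(p ` Z)\<inverse> \<subseteq> (p ` Z)\<^sup>*"
  proof (rule subrelI)
    fix x y assume "(x, y) \<in> (p ` Z)\<inverse>"
    then obtain e where "e \<in> Z" "p e = (y, x)" by (auto simp: eq_commute)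
    then show "(x, y) \<in> (p ` Z)\<^sup>*" using assms(4) by (force simp: circ_sets_def)
  qed
  then have conv: "(p ` Z)\<inverse> \<subseteq> (p ` (Z \<union> B))\<^sup>*" for B
    using rtrancl_mono[of "p ` Z" "p ` (Z \<union> B)"] by auto
  have rt: "(p ` B \<union> F)\<^sup>* = (p ` (Z \<union> B))\<^sup>*" for B
  proof -
    have "p ` B \<union> F = (p ` Z)\<inverse> \<union> p ` (Z \<union> B)" by (auto simp: F_def)
    then show ?thesis using rtrancl_subsumed[OF conv] by simp
  qed
  have eq: "equiv_cl (p ` B \<union> F) = equiv_cl (p ` (Z \<union> B))" for B
    unfolding equiv_cl_def F_def by (rule arg_cong[where f = rtrancl]) auto
  have ZB: "Z \<union> B \<in> circ_sets p {} A \<longleftrightarrow> B \<in> circ_sets p F (C - Z)" if "B \<subseteq> C - Z" for B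
  proof -
    have "prod.swap (p e) \<in> (p ` (Z \<union> B))\<^sup>*" if "e \<in> Z" for e
      using assms(4) that rtrancl_mono[of "p ` Z" "p ` (Z \<union> B)"] by (auto simp: circ_sets_def)
    then show ?thesis
      using that subA by (auto simp: circ_sets_def rt)
  qed
  have img: "{B \<in> circ_sets p {} A. Z \<subseteq> B \<and> B \<subseteq> C} = (\<union>) Z ` circ_sets p F (C - Z)"
  proof (intro equalityI subsetI)
    fix B assume "B \<in> {B \<in> circ_sets p {} A. Z \<subseteq> B \<and> B \<subseteq> C}"
    then have B: "B \<in> circ_sets p {} A" "Z \<subseteq> B" "B \<subseteq> C" by auto
    then have "Z \<union> (B - Z) = B" "B - Z \<subseteq> C - Z" by auto
    then show "B \<in> (\<union>) Z ` circ_sets p F (C - Z)" using ZB[of "B - Z"] B(1) by (metis imageI)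
  next
    fix B assume "B \<in> (\<union>) Z ` circ_sets p F (C - Z)"
    then obtain X where X: "B = Z \<union> X" "X \<in> circ_sets p F (C - Z)" by blast
    moreover from X have "X \<subseteq> C - Z" by (auto simp: circ_sets_def)
    ultimately show "B \<in> {B \<in> circ_sets p {} A. Z \<subseteq> B \<and> B \<subseteq> C}"
      using ZB[of X] assms(6) by auto
  qed
  have inj: "inj_on ((\<union>) Z) (circ_sets p F (C - Z))"
    by (rule inj_onI) (auto simp: circ_sets_def)
  \<comment> \<open>The exponents differ by a parity that is constant on the interval; multiplying
    by \<open>(-1) ^ card V\<close> replaces the subtraction in \<open>nullity\<close>.\<close>
  have sign: "(-1 :: int) ^ nullity V p (Z \<union> B) = (-1) ^ (card V + card Z) * comp_sign V p F B"
    if "B \<in> circ_sets p F (C - Z)" for B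
  proof -
    have B: "B \<subseteq> C - Z" using that by (auto simp: circ_sets_def)
    then have fin: "finite (Z \<union> B)" "p ` (Z \<union> B) \<subseteq> V \<times> V"
      using finC assms(6) finite_subset[of "Z \<union> B" C] by blast+
    have "card (Z \<union> B) = card Z + card B"
      using B fin(1) by (intro card_Un_disjoint) auto
    then have "nullity V p (Z \<union> B) + card V = card Z + (card B + n_comps V (p ` B \<union> F))"
      using nullity_eq[OF assms(1) fin] by (simp add: n_comps_def eq)
    then have "(-1 :: int) ^ (nullity V p (Z \<union> B) + card V) = (-1) ^ card Z * comp_sign V p F B"
      unfolding comp_sign_def by (simp add: power_add)
    then have "(-1 :: int) ^ (nullity V p (Z \<union> B) + card V) * (-1) ^ card V =
        (-1) ^ (card V + card Z) * comp_sign V p F B"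
      by (simp add: power_add)
    moreover have "(-1 :: int) ^ (nullity V p (Z \<union> B) + card V) * (-1) ^ card V = (-1) ^ nullity V p (Z \<union> B)"
      by (simp add: power_add mult.assoc flip: power_mult_distrib)
    ultimately show ?thesis by simp
  qed
  have "(\<Sum>B \<in> {B \<in> circ_sets p {} A. Z \<subseteq> B \<and> B \<subseteq> C}. (-1 :: int) ^ nullity V p B) =
      (\<Sum>B \<in> circ_sets p F (C - Z). (-1) ^ nullity V p (Z \<union> B))"
    unfolding img by (subst sum.reindex[OF inj]) simp
  also have "\<dots> = (-1) ^ (card V + card Z) * sum (comp_sign V p F) (circ_sets p F (C - Z))"
    by (simp add: sign sum_distrib_left)
  also have "sum (comp_sign V p F) (circ_sets p F (C - Z)) = 0"
  proof -
    have "Z \<union> (C - Z) = C" using assms(6) by auto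
    then have "C - Z \<in> circ_sets p F (C - Z)" using ZB[of "C - Z"] assms(5) by simp
    moreover have "C - Z \<noteq> {}" using assms(6) by auto
    ultimately have "circ_sets p F (C - Z) \<noteq> {{}}" by (metis singletonD)
    then show ?thesis
      using sum_comp_sign_circ_sets[OF assms(1) finCZ symF] by simp
  qed
  finally show ?thesis by simp
qed

section \<open>Totally cyclic subdigraphs and unions of directed cycles\<close>

lemma (in wf_digraph) reachable_iff_rtrancl:
  "u \<rightarrow>\<^sup>* v \<longleftrightarrow> u \<in> verts G \<and> (u, v) \<in> (arcs_ends G)\<^sup>*"
proof
  assume "u \<rightarrow>\<^sup>* v"
  then show "u \<in> verts G \<and> (u, v) \<in> (arcs_ends G)\<^sup>*"
    using reachable_in_verts reachable_rtranclI by metis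
next
  assume *: "u \<in> verts G \<and> (u, v) \<in> (arcs_ends G)\<^sup>*"
  then have "(u, v) \<in> (arcs_ends G)\<^sup>*" by simp
  then show "u \<rightarrow>\<^sup>* v"
    by (induction rule: rtrancl_induct) (use * in \<open>auto intro: reachable_adj_trans\<close>)
qed

lemma (in wf_digraph) connected_iff_equiv_cl:
  "connected G \<longleftrightarrow> verts G \<noteq> {} \<and> (\<forall>u \<in> verts G. \<forall>v \<in> verts G. (u, v) \<in> equiv_cl (arcs_ends G))"
proof -
  interpret S: pair_wf_digraph "mk_symmetric G" ..
  have "arcs_ends (mk_symmetric G) = arcs_ends G \<union> (arcs_ends G)\<inverse>"
    by (auto simp: parcs_mk_symmetric arcs_ends_conv)
  then show ?thesis
    unfolding connected_def strongly_connected_def S.reachable_iff_rtrancl equiv_cl_def by simp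
qed

text \<open>Among the connected subdigraphs through \<open>e\<close>, of which the single arc is
  one, a largest by vertices plus arcs is maximal.\<close>

lemma (in fin_digraph) weak_component_of_arc:
  assumes "e \<in> arcs G"
  obtains H where "H \<in> weak_components G" "e \<in> arcs H"
proof -
  let ?P = "\<lambda>H. subgraph H G \<and> connected H \<and> e \<in> arcs H"
  let ?m = "\<lambda>H :: ('a, 'b) pre_digraph. card (verts H) + card (arcs H)"
  define H0 where "H0 = \<lparr>verts = {tail G e, head G e}, arcs = {e}, tail = tail G, head = head G\<rparr>"
  interpret H0: wf_digraph H0 by unfold_locales (auto simp: H0_def)
  have "(tail G e, head G e) \<in> equiv_cl (arcs_ends H0)"
    by (auto simp: equiv_cl_def H0_def arcs_ends_conv)
  then have "connected H0"
    unfolding H0.connected_iff_equiv_cl using equiv_cl_sym[of "tail G e"] by (auto simp: H0_def)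
  moreover have "subgraph H0 G"
    using assms H0.wf_digraph wf_digraph by (auto simp: subgraph_def H0_def compatible_def)
  ultimately have "?P H0" by (simp add: H0_def)
  moreover have "?m H < card (verts G) + card (arcs G) + 1" if "?P H" for H
    using that card_mono[of "verts G" "verts H"] card_mono[of "arcs G" "arcs H"] by (auto simp: subgraph_def)
  ultimately obtain H where H: "?P H" "\<And>H'. ?P H' \<Longrightarrow> ?m H' \<le> ?m H"
    using ex_has_greatest_nat[of ?P H0 ?m "card (verts G) + card (arcs G) + 1"] by blast
  have "\<not> connected H'" if H': "H \<noteq> H'" "subgraph H H'" "subgraph H' G" for H'
  proof
    assume "connected H'"
    moreover have "e \<in> arcs H'" using H(1) H'(2) by (auto simp: subgraph_def)
    ultimately have le: "?m H' \<le> ?m H" using H(2) H'(3) by blast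
    have sub: "verts H \<subseteq> verts H'" "arcs H \<subseteq> arcs H'" using H'(2) by (auto simp: subgraph_def)
    have fin: "finite (verts H')" "finite (arcs H')"
      using H'(3) finite_subset[of _ "verts G"] finite_subset[of _ "arcs G"] by (auto simp: subgraph_def)
    have "card (verts H) \<le> card (verts H')" "card (arcs H) \<le> card (arcs H')"
      using sub fin by (auto intro: card_mono)
    then have "card (verts H) = card (verts H')" "card (arcs H) = card (arcs H')" using le by auto
    then have "verts H = verts H'" "arcs H = arcs H'"
      using card_subset_eq[OF fin(1) sub(1)] card_subset_eq[OF fin(2) sub(2)] by auto
    then have "H = H'" using H'(2) by (auto simp: subgraph_def compatible_def intro: pre_digraph.equality)
    then show False using H'(1) by simp
  qed
  then have "max_subgraph connected H" using H(1) by (intro max_subgraphI) auto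
  then show thesis using H(1) that by (auto simp: weak_components_def)
qed

text \<open>Adding \<open>a\<close> with its head keeps the subdigraph connected, so by maximality
  both already belong to it.\<close>

lemma (in wf_digraph) weak_component_closed:
  assumes "H \<in> weak_components G" "a \<in> arcs G" "tail G a \<in> verts H"
  shows "a \<in> arcs H" "head G a \<in> verts H"
proof -
  have max: "max_subgraph connected H" using assms(1) by (simp add: weak_components_def)
  then have sub: "subgraph H G" and con: "connected H" by (auto simp: max_subgraph_def)
  interpret H: wf_digraph H using sub by (simp add: subgraph_def)
  have ends: "tail H = tail G" "head H = head G" using sub by (auto simp: subgraph_def compatible_def)
  let ?K = "pre_digraph.add_arc H a"
  have K: "verts ?K = insert (head G a) (verts H)" "arcs ?K = insert a (arcs H)" "tail ?K = tail G" "head ?K = head G"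
    using assms(3) ends by (auto simp: pre_digraph.add_arc_def)
  interpret K: wf_digraph ?K
    using H.tail_in_verts H.head_in_verts assms(3) ends by unfold_locales (auto simp: K)
  have HK: "subgraph H ?K"
    using H.wf_digraph K.wf_digraph ends by (auto simp: subgraph_def compatible_def K)
  have KG: "subgraph ?K G"
    using sub K.wf_digraph assms(2) head_in_verts[OF assms(2)] by (simp add: subgraph_def compatible_def K)
  have "connected ?K"
  proof -
    have "arcs_ends H \<subseteq> arcs_ends ?K" by (auto simp: arcs_ends_conv K ends)
    then have mono: "equiv_cl (arcs_ends H) \<subseteq> equiv_cl (arcs_ends ?K)" by (rule equiv_cl_mono)
    have a: "(tail G a, head G a) \<in> equiv_cl (arcs_ends ?K)"
      by (auto simp: equiv_cl_def arcs_ends_conv K ends)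
    have t: "(tail G a, w) \<in> equiv_cl (arcs_ends ?K)" if "w \<in> verts ?K" for w
      using that a con mono assms(3) unfolding H.connected_iff_equiv_cl K(1) by auto
    have "(u, v) \<in> equiv_cl (arcs_ends ?K)" if "u \<in> verts ?K" "v \<in> verts ?K" for u v
      by (rule equiv_cl_trans[OF equiv_cl_sym[OF t[OF that(1)]] t[OF that(2)]])
    moreover have "verts ?K \<noteq> {}" by (simp add: K)
    ultimately show ?thesis unfolding K.connected_iff_equiv_cl by blast
  qed
  then have "?K = H" using max HK KG unfolding max_subgraph_def by blast
  then show "a \<in> arcs H" "head G a \<in> verts H" using K by auto
qed

text \<open>Directed walks cannot leave a weak component. Return paths therefore stay inside it, and
  there \<open>circ_sets_equiv_cl\<close> turns weak into strong connectivity.\<close>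

lemma (in fin_digraph) totally_cyclic_iff:
  "totally_cyclic G \<longleftrightarrow> (\<forall>e \<in> arcs G. (head G e, tail G e) \<in> (arcs_ends G)\<^sup>*)"
proof
  assume tc: "totally_cyclic G"
  show "\<forall>e \<in> arcs G. (head G e, tail G e) \<in> (arcs_ends G)\<^sup>*"
  proof
    fix e assume "e \<in> arcs G"
    then obtain H where H: "H \<in> weak_components G" "e \<in> arcs H" by (rule weak_component_of_arc)
    then have sub: "subgraph H G" by (simp add: weak_components_def max_subgraph_def)
    interpret H: wf_digraph H using sub by (simp add: subgraph_def)
    have ends: "tail H = tail G" "head H = head G" using sub by (auto simp: subgraph_def compatible_def)
    have "head H e \<rightarrow>\<^sup>*\<^bsub>H\<^esub> tail H e"
      using tc H unfolding totally_cyclic_def strongly_connected_def by simp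
    then have "(head G e, tail G e) \<in> (arcs_ends H)\<^sup>*"
      unfolding H.reachable_iff_rtrancl ends by simp
    then show "(head G e, tail G e) \<in> (arcs_ends G)\<^sup>*"
      using rtrancl_mono[OF arcs_ends_mono[OF sub]] by blast
  qed
next
  assume ret: "\<forall>e \<in> arcs G. (head G e, tail G e) \<in> (arcs_ends G)\<^sup>*"
  show "totally_cyclic G"
    unfolding totally_cyclic_def
  proof
    fix H assume H: "H \<in> weak_components G"
    then have sub: "subgraph H G" and con: "connected H" by (simp_all add: weak_components_def max_subgraph_def)
    interpret H: wf_digraph H using sub by (simp add: subgraph_def)
    have ends: "tail H = tail G" "head H = head G" using sub by (auto simp: subgraph_def compatible_def)
    have stay: "(u, w) \<in> (arcs_ends H)\<^sup>* \<and> w \<in> verts H" if "(u, w) \<in> (arcs_ends G)\<^sup>*" "u \<in> verts H" for u w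
      using that
    proof (induction rule: rtrancl_induct)
      case (step w z)
      then obtain a where a: "a \<in> arcs G" "tail G a = w" "head G a = z" by (auto simp: arcs_ends_conv)
      then have "a \<in> arcs H" "z \<in> verts H" using weak_component_closed[OF H, of a] step by auto
      moreover from this have "(w, z) \<in> arcs_ends H" using a ends by (auto simp: arcs_ends_conv)
      ultimately show ?case using step by (auto intro: rtrancl_into_rtrancl)
    qed simp
    have "(head H e, tail H e) \<in> (arcs_ends H)\<^sup>*" if "e \<in> arcs H" for e
    proof -
      have "e \<in> arcs G" using that sub by (auto simp: subgraph_def)
      then have "(head H e, tail H e) \<in> (arcs_ends G)\<^sup>*" using ret unfolding ends by blast
      then show ?thesis using stay H.head_in_verts[OF that] by blast
    qed
    then have "arcs H \<in> circ_sets (arc_to_ends H) {} (arcs H)"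
      by (simp add: circ_sets_def arcs_ends_def) (simp add: arc_to_ends_def)
    then have "equiv_cl (arcs_ends H) = (arcs_ends H)\<^sup>*"
      using circ_sets_equiv_cl[of "arcs H" "arc_to_ends H" "{}" "arcs H"] by (simp add: arcs_ends_def sym_def)
    then show "strongly_connected H"
      using con unfolding strongly_connected_def H.connected_iff_equiv_cl H.reachable_iff_rtrancl by auto
  qed
qed

lemma totally_cyclic_sets_eq:
  assumes "fin_digraph D"
  shows "totally_cyclic_sets D = circ_sets (arc_to_ends D) {} (arcs D)"
proof -
  interpret fin_digraph D by fact
  have "totally_cyclic (arc_subdigraph D B) \<longleftrightarrow>
      (\<forall>e \<in> B. prod.swap (arc_to_ends D e) \<in> (arc_to_ends D ` B)\<^sup>*)" if "B \<subseteq> arcs D" for B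
  proof -
    interpret S: fin_digraph "arc_subdigraph D B"
      using finite_subset[OF that finite_arcs] by unfold_locales (auto simp: arc_subdigraph_def)
    have "arc_to_ends (arc_subdigraph D B) = arc_to_ends D"
      by (auto simp: arc_to_ends_def arc_subdigraph_def)
    then show ?thesis
      unfolding S.totally_cyclic_iff arcs_ends_def by (simp add: arc_to_ends_def arc_subdigraph_def)
  qed
  then show ?thesis unfolding totally_cyclic_sets_def circ_sets_def by auto
qed

section \<open>Directed cycles and return paths\<close>

lemma (in pre_digraph) cas_imp_rtrancl:
  "cas u p v \<Longrightarrow> set p \<subseteq> C \<Longrightarrow> (u, v) \<in> (arc_to_ends G ` C)\<^sup>*"
proof (induction p arbitrary: u)
  case (Cons e p)
  then have "(head G e, v) \<in> (arc_to_ends G ` C)\<^sup>*" "(u, head G e) \<in> arc_to_ends G ` C"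
    by (auto simp: arc_to_ends_def)
  then show ?case by (meson converse_rtrancl_into_rtrancl)
qed simp

lemma (in wf_digraph) cycle_through_arc:
  assumes "C \<in> circ_sets (arc_to_ends G) {} (arcs G)" "e \<in> C"
  obtains p where "cycle p" "e \<in> set p" "set p \<subseteq> C"
proof -
  let ?H = "G\<lparr>arcs := C\<rparr>"
  have C: "C \<subseteq> arcs G" using assms(1) by (simp add: circ_sets_def)
  interpret H: wf_digraph ?H using C by unfold_locales auto
  have comp: "compatible G ?H" by (simp add: compatible_def)
  have "arcs_ends ?H = arc_to_ends G ` C" by (simp add: arcs_ends_def arc_to_ends_def)
  then have "(head G e, tail G e) \<in> (arcs_ends ?H)\<^sup>*"
    using assms by (auto simp: circ_sets_def arc_to_ends_def)
  moreover have "head G e \<in> verts ?H" using assms(2) C by auto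
  ultimately obtain p where p: "H.apath (head G e) p (tail G e)"
    using H.reachable_iff_rtrancl H.reachable_apath by blast
  then have cas: "cas (head G e) p (tail G e)" and dist: "distinct (awalk_verts (head G e) p)"
    and set: "set p \<subseteq> C"
    unfolding H.apath_def H.awalk_def compatible_cas[OF comp] compatible_awalk_verts[OF comp] by auto
  have "awalk (tail G e) (e # p) (tail G e)"
    using cas set C assms(2) by (auto simp: awalk_def)
  \<comment> \<open>\<open>cycle\<close> asks for distinct vertices after the first one, and these
    are exactly the vertices of the simple path \<open>p\<close>. For a loop \<open>e\<close>,
    \<open>p\<close> is empty.\<close>
  then have "cycle (e # p)" using dist by (auto simp: cycle_def)
  then show thesis using set assms(2) by (intro that[of "e # p"]) auto
qed

lemma cycle_unions_eq:
  assumes "fin_digraph D"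
  shows "cycle_unions D = circ_sets (arc_to_ends D) {} (arcs D)"
proof (intro equalityI subsetI)
  interpret fin_digraph D by fact
  fix C assume C: "C \<in> cycle_unions D"
  then obtain S where S: "C = \<Union> (set ` S)" "\<forall>p \<in> S. cycle p" by (auto simp: cycle_unions_def)
  have "prod.swap (arc_to_ends D e) \<in> (arc_to_ends D ` C)\<^sup>*" if e: "e \<in> C" for e
  proof -
    obtain p where p: "p \<in> S" "e \<in> set p" using e S(1) by auto
    then obtain u where "cas u p u" using S(2) by (auto simp: cycle_def awalk_def)
    \<comment> \<open>The cycle is cut at \<open>e\<close>: following \<open>r\<close> and then
      \<open>q\<close> leads from the head of \<open>e\<close> back to its tail.\<close>
    moreover obtain q r where qr: "p = q @ e # r" using p(2) by (auto simp: in_set_conv_decomp)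
    ultimately have "cas u q (tail D e)" "cas (head D e) r u" by (auto simp: cas_append_iff)
    moreover have "set q \<subseteq> C" "set r \<subseteq> C" using p(1) S(1) qr by auto
    ultimately have "(head D e, u) \<in> (arc_to_ends D ` C)\<^sup>*" "(u, tail D e) \<in> (arc_to_ends D ` C)\<^sup>*"
      using cas_imp_rtrancl by blast+
    then have "(head D e, tail D e) \<in> (arc_to_ends D ` C)\<^sup>*" by (rule rtrancl_trans)
    then show ?thesis by (simp add: arc_to_ends_def)
  qed
  then show "C \<in> circ_sets (arc_to_ends D) {} (arcs D)"
    using cycle_unions_subset[OF C] by (simp add: circ_sets_def)
next
  interpret fin_digraph D by fact
  fix C assume C: "C \<in> circ_sets (arc_to_ends D) {} (arcs D)"
  then have fin: "finite C" using finite_subset[OF _ finite_arcs] by (simp add: circ_sets_def)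
  have "\<forall>e \<in> C. \<exists>p. cycle p \<and> e \<in> set p \<and> set p \<subseteq> C"
    using cycle_through_arc[OF C] by metis
  then obtain f where f: "\<forall>e \<in> C. cycle (f e) \<and> e \<in> set (f e) \<and> set (f e) \<subseteq> C" by metis
  then have "C = \<Union> (set ` (f ` C))" by auto
  then show "C \<in> cycle_unions D"
    unfolding cycle_unions_def using f fin by (intro CollectI exI[of _ "f ` C"]) auto
qed

section \<open>The Moebius function\<close>

lemma rk_Q_eq_nullity:
  assumes "fin_digraph D" "B \<in> totally_cyclic_sets D"
  shows "rk_Q D B = nullity (verts D) (arc_to_ends D) B"
proof -
  interpret fin_digraph D by fact
  have ends: "arc_to_ends D ` arcs D \<subseteq> verts D \<times> verts D" by (auto simp: arc_to_ends_def)
  note Q = totally_cyclic_sets_eq[OF assms(1)]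
  let ?n = "nullity (verts D) (arc_to_ends D) B"
  let ?R = "{r. \<exists>c :: nat \<Rightarrow> 'b set. c 0 = {} \<and> c r = B \<and>
     (\<forall>i \<le> r. c i \<in> totally_cyclic_sets D) \<and> (\<forall>i < r. c i \<subset> c (Suc i))}"
  have le: "r \<le> ?n" if "r \<in> ?R" for r
    using that chain_length_le_nullity[OF finite_verts finite_arcs ends] unfolding Q by blast
  moreover have "?n \<in> ?R"
    using circ_sets_chain[OF finite_verts finite_arcs ends] assms(2) unfolding Q by blast
  moreover have "finite ?R" by (rule finite_subset[of _ "{..?n}"]) (use le in auto)
  ultimately show ?thesis unfolding rk_Q_def by (intro Max_eqI) auto
qed

text \<open>Contraction reverses inclusion, so \<open>contract D C\<close> is the lower element and
  the recursion sums over the sets \<open>B\<close> with \<open>Z \<subset> B \<subseteq> C\<close>.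
  By \<open>sum_sign_interval\<close> the product of the two signs solves this recursion.\<close>

lemma moebius_cycle_contractions:
  assumes "fin_digraph D" "Z \<in> cycle_unions D" "C \<in> cycle_unions D" "Z \<subseteq> C"
  shows "moebius (cycle_contractions D) (cycle_contraction_order D) (contract D C) (contract D Z) =
    (-1) ^ (nullity (verts D) (arc_to_ends D) C + nullity (verts D) (arc_to_ends D) Z)"
  using assms(2-)
proof (induction "card (C - Z)" arbitrary: Z rule: less_induct)
  case less
  interpret fin_digraph D by fact
  let ?P = "cycle_contractions D" and ?le = "cycle_contraction_order D" and ?U = "cycle_unions D"
  let ?n = "nullity (verts D) (arc_to_ends D)"
  have ends: "arc_to_ends D ` arcs D \<subseteq> verts D \<times> verts D" by (auto simp: arc_to_ends_def)
  note inj = inj_on_contract[of D]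
  have le: "(contract D X, contract D Y) \<in> ?le \<longleftrightarrow> Y \<subseteq> X" if "X \<in> ?U" "Y \<in> ?U" for X Y
    unfolding cycle_contraction_order_def using that inj_onD[OF inj] by blast
  have fin: "finite ?P" and po: "partial_order_on ?P ?le"
    using finite_cycle_contractions[OF assms(1)] partial_order_on_cycle_contractions by auto
  have CZ: "(contract D C, contract D Z) \<in> ?le" using le less.prems by blast
  show ?case
  proof (cases "C = Z")
    case True
    then show ?thesis using fin po CZ by (subst moebius.simps) (simp flip: power_mult_distrib add: power_add)
  next
    case False
    define I where "I = {B \<in> ?U. Z \<subseteq> B \<and> B \<subseteq> C}"
    have "I \<subseteq> ?U" by (auto simp: I_def)
    have finI: "finite I"
      using cycle_unions_subset finite_arcs by (intro finite_subset[of I "Pow (arcs D)"]) (auto simp: I_def)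
    have ZI: "Z \<in> I" using less.prems by (auto simp: I_def)
    have set: "{z \<in> ?P. (contract D C, z) \<in> ?le \<and> (z, contract D Z) \<in> ?le \<and> z \<noteq> contract D Z} =
        contract D ` (I - {Z})"
      using le less.prems inj_onD[OF inj] unfolding cycle_contractions_def I_def by blast
    have IH: "moebius ?P ?le (contract D C) (contract D B) = (-1) ^ (?n C + ?n B)" if "B \<in> I - {Z}" for B
    proof (rule less.hyps)
      have "C - B \<subset> C - Z" using that by (auto simp: I_def)
      moreover have "finite (C - Z)"
        using cycle_unions_subset[OF less.prems(2)] finite_arcs finite_subset by blast
      ultimately show "card (C - B) < card (C - Z)" by (rule psubset_card_mono[rotated])
    qed (use that less.prems in \<open>auto simp: I_def\<close>)
    have "Z \<subset> C" using False less.prems(3) by auto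
    then have zero: "(\<Sum>B \<in> I. (-1 :: int) ^ ?n B) = 0"
      using sum_sign_interval[OF finite_verts finite_arcs ends] less.prems(1,2)
      unfolding I_def cycle_unions_eq[OF assms(1)] by blast
    have "moebius ?P ?le (contract D C) (contract D Z) =
        - (\<Sum>z \<in> contract D ` (I - {Z}). moebius ?P ?le (contract D C) z)"
      using fin po CZ inj_onD[OF inj, of C Z] less.prems False by (subst moebius.simps) (auto simp: set)
    also have "(\<Sum>z \<in> contract D ` (I - {Z}). moebius ?P ?le (contract D C) z) =
        (\<Sum>B \<in> I - {Z}. moebius ?P ?le (contract D C) (contract D B))"
      by (subst sum.reindex) (use inj_on_subset[OF inj, of "I - {Z}"] \<open>I \<subseteq> ?U\<close> in auto)
    also have "\<dots> = (\<Sum>B \<in> I - {Z}. (-1) ^ ?n C * (-1) ^ ?n B)"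
      by (rule sum.cong[OF refl]) (simp add: IH power_add)
    \<comment> \<open>The recursion omits the term of \<open>Z\<close>; completing the sum to the
      whole interval makes it vanish and leaves that term.\<close>
    also have "\<dots> = (-1) ^ ?n C * ((\<Sum>B \<in> I. (-1) ^ ?n B) - (-1) ^ ?n Z)"
      using finI ZI by (simp add: sum_diff1 flip: sum_distrib_left)
    finally show ?thesis using zero by (simp add: power_add)
  qed
qed

theorem theorem3p4:
  fixes D :: "('a, 'b) pre_digraph"
  assumes "fin_digraph D"
  shows "psi_NL D =
    (\<Sum>B \<in> totally_cyclic_sets D. monom ((-1) ^ rk_Q D B) (digraph_rk (contract D B)))"
proof -
  have QU: "totally_cyclic_sets D = cycle_unions D"
    using totally_cyclic_sets_eq[OF assms] cycle_unions_eq[OF assms] by simp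
  \<comment> \<open>The empty set has nullity 0, so only the nullity of \<open>B\<close>, its rank,
    remains in the exponent.\<close>
  have "moebius (cycle_contractions D) (cycle_contraction_order D) (contract D B) (contract D {}) =
      (-1) ^ rk_Q D B" if "B \<in> cycle_unions D" for B
    using moebius_cycle_contractions[OF assms empty_in_cycle_unions that] rk_Q_eq_nullity[OF assms, of B] that QU
    by (simp add: nullity_def[of _ _ "{}"] n_comps_empty)
  then show ?thesis
    unfolding psi_NL_def cycle_contractions_def QU
    by (subst sum.reindex[OF inj_on_contract]) (simp add: cycle_contractions_def[symmetric])
qed

end
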